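(* Let $\nu>0$ be real and let $m\ge0$ be an integer. The space $\mathcal{B}^{2,\nu}_{m}(\mathbb{C})$, equipped with the scalar product $\langle\cdot,\cdot\rangle_{\nu,m}$, is a reproducing kernel Hilbert space. Its reproducing kernel is given, for $z,w\in\mathbb{C}$, by $$K^{\nu}_{m}(z,w)=\frac{\nu}{\pi}\left(\sum_{k=0}^{m-1}\frac{(\nu z\overline{w})^k}{k!}+\frac{(z\overline{w})^m}{\Gamma^2(m+1)}\;{}_2F_2\left(\begin{array}{c} 1,1 \\ m+1,m+1 \end{array}\bigg|\nu z\overline{w}\right)\right).$$ Moreover, a function $f(z)=\sum_{n=0}^{+\infty}a_nz^n$ (a power series convergent on $\mathbb{C}$) belongs to $\mathcal{B}^{2,\nu}_m(\mathbb{C})$ if and only if $$\|f\|_{\nu,m}^2=\pi\left\{\sum_{n=0}^{m-1}\frac{n!}{\nu^{n+1}}|a_n|^2+\sum_{n=m}^{+\infty}\frac{(n!)^2}{\nu^{n-m+1}(n-m)!}|a_n|^2\right\}<+\infty.$$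
   Context: $d\lambda$ is the two-dimensional Lebesgue measure on $\mathbb{C}$. For $\nu>0$ put $\langle f,g\rangle_\nu=\int_{\mathbb{C}}f(z)\overline{g(z)}e^{-\nu|z|^2}d\lambda(z)$ and $\|f\|_\nu^2=\int_{\mathbb{C}}|f(z)|^2e^{-\nu|z|^2}d\lambda(z)\in[0,+\infty]$. $\mathcal{H}ol(\mathbb{C})$ is the space of entire functions $f(z)=\sum_{n\ge0}a_nz^n$. For such $f$ and an integer $m\ge0$, write $f=f_{1,m}+f_{2,m}$ with $f_{1,m}(z)=\sum_{n=0}^{m-1}a_nz^n$ (zero if $m=0$) and $f_{2,m}(z)=\sum_{n=m}^{\infty}a_nz^n$. The space $\mathcal{B}^{2,\nu}_m(\mathbb{C})$ consists of all $f\in\mathcal{H}ol(\mathbb{C})$ with $\|f\|_{\nu,m}^2:=\|f_{1,m}\|_\nu^2+\|f_{2,m}^{(m)}\|_\nu^2<+\infty$, where $f^{(m)}$ denotes the $m$-th complex derivative. Its scalar product is $\langle f,g\rangle_{\nu,m}=\langle f_{1,m},g_{1,m}\rangle_\nu+\langle f_{2,m}^{(m)},g_{2,m}^{(m)}\rangle_\nu$. The hypergeometric function is ${}_2F_2\left(\begin{array}{c} a,b \\ a',b' \end{array}\bigg|x\right)=\sum_{k\ge0}\frac{(a)_k(b)_k}{(a')_k(b')_k}\frac{x^k}{k!}$, with $(a)_k=a(a+1)\cdots(a+k-1)$, $(a)_0=1$. Empty sums are $0$. *)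

theory Defs
  imports "HOL-Complex_Analysis.Complex_Analysis"
begin

text \<open>
  Isabelle's function space has no complex inner product structure, so Hilbert spaces of
  functions are described by a carrier \<open>H\<close> of complex-valued functions together with a form
  \<open>ip\<close> that is linear in its first argument; only values on \<open>H\<close> matter.
\<close>

locale complex_inner_function_space =
  fixes H :: "('a \<Rightarrow> complex) set"
    and ip :: "('a \<Rightarrow> complex) \<Rightarrow> ('a \<Rightarrow> complex) \<Rightarrow> complex"
  assumes zero_mem: "(\<lambda>_. 0) \<in> H"
    and add_mem: "f \<in> H \<Longrightarrow> g \<in> H \<Longrightarrow> (\<lambda>x. f x + g x) \<in> H"
    and scale_mem: "f \<in> H \<Longrightarrow> (\<lambda>x. c * f x) \<in> H"
    and ip_add_left: "f \<in> H \<Longrightarrow> g \<in> H \<Longrightarrow> h \<in> H \<Longrightarrow> ip (\<lambda>x. f x + g x) h = ip f h + ip g h"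
    and ip_scale_left: "f \<in> H \<Longrightarrow> g \<in> H \<Longrightarrow> ip (\<lambda>x. c * f x) g = c * ip f g"
    and ip_commute: "f \<in> H \<Longrightarrow> g \<in> H \<Longrightarrow> ip g f = cnj (ip f g)"
    and ip_nonneg: "f \<in> H \<Longrightarrow> 0 \<le> Re (ip f f)"
    and ip_definite: "f \<in> H \<Longrightarrow> ip f f = 0 \<Longrightarrow> f = (\<lambda>_. 0)"

definition ip_norm :: "(('a \<Rightarrow> complex) \<Rightarrow> ('a \<Rightarrow> complex) \<Rightarrow> complex) \<Rightarrow> ('a \<Rightarrow> complex) \<Rightarrow> real" where
  "ip_norm ip f = sqrt (Re (ip f f))"

locale complex_hilbert_function_space = complex_inner_function_space +
  assumes complete:
    "(\<And>n :: nat. F n \<in> H) \<Longrightarrow>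
     (\<And>e. e > 0 \<Longrightarrow> \<exists>N. \<forall>i\<ge>N. \<forall>j\<ge>N. ip_norm ip (\<lambda>x. F i x - F j x) < e) \<Longrightarrow>
     \<exists>f\<in>H. (\<lambda>n. ip_norm ip (\<lambda>x. F n x - f x)) \<longlonglongrightarrow> 0"

locale reproducing_kernel_hilbert_space = complex_hilbert_function_space +
  assumes eval_bounded: "\<exists>C. \<forall>f\<in>H. cmod (f x) \<le> C * ip_norm ip f"

definition is_reproducing_kernel ::
  "('a \<Rightarrow> complex) set \<Rightarrow> (('a \<Rightarrow> complex) \<Rightarrow> ('a \<Rightarrow> complex) \<Rightarrow> complex) \<Rightarrow> ('a \<Rightarrow> 'a \<Rightarrow> complex) \<Rightarrow> bool" where
  "is_reproducing_kernel H ip K \<longleftrightarrow>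
     (\<forall>w. (\<lambda>z. K z w) \<in> H \<and> (\<forall>f\<in>H. f w = ip f (\<lambda>z. K z w)))"


definition gauss_ip :: "real \<Rightarrow> (complex \<Rightarrow> complex) \<Rightarrow> (complex \<Rightarrow> complex) \<Rightarrow> complex" where
  "gauss_ip \<nu> f g = (LINT z|lborel. f z * cnj (g z) * of_real (exp (- \<nu> * (cmod z)\<^sup>2)))"

definition gauss_normsq :: "real \<Rightarrow> (complex \<Rightarrow> complex) \<Rightarrow> ennreal" where
  "gauss_normsq \<nu> f = (\<integral>\<^sup>+z. ennreal ((cmod (f z))\<^sup>2 * exp (- \<nu> * (cmod z)\<^sup>2)) \<partial>lborel)"

definition taylor_coeff :: "(complex \<Rightarrow> complex) \<Rightarrow> nat \<Rightarrow> complex" where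
  "taylor_coeff f n = fps_nth (fps_expansion f 0) n"

definition low_part :: "nat \<Rightarrow> (complex \<Rightarrow> complex) \<Rightarrow> complex \<Rightarrow> complex" where
  "low_part m f z = (\<Sum>n<m. taylor_coeff f n * z ^ n)"

definition high_part :: "nat \<Rightarrow> (complex \<Rightarrow> complex) \<Rightarrow> complex \<Rightarrow> complex" where
  "high_part m f z = (\<Sum>k. taylor_coeff f (m + k) * z ^ (m + k))"

definition bargmann_normsq :: "real \<Rightarrow> nat \<Rightarrow> (complex \<Rightarrow> complex) \<Rightarrow> ennreal" where
  "bargmann_normsq \<nu> m f =
     gauss_normsq \<nu> (low_part m f) + gauss_normsq \<nu> ((deriv ^^ m) (high_part m f))"

definition bargmann_ip :: "real \<Rightarrow> nat \<Rightarrow> (complex \<Rightarrow> complex) \<Rightarrow> (complex \<Rightarrow> complex) \<Rightarrow> complex" where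
  "bargmann_ip \<nu> m f g =
     gauss_ip \<nu> (low_part m f) (low_part m g) +
     gauss_ip \<nu> ((deriv ^^ m) (high_part m f)) ((deriv ^^ m) (high_part m g))"

definition bargmann_space :: "real \<Rightarrow> nat \<Rightarrow> (complex \<Rightarrow> complex) set" where
  "bargmann_space \<nu> m = {f. f holomorphic_on UNIV \<and> bargmann_normsq \<nu> m f < \<infinity>}"


definition hypergeom_2F2 :: "complex \<Rightarrow> complex \<Rightarrow> complex \<Rightarrow> complex \<Rightarrow> complex \<Rightarrow> complex" where
  "hypergeom_2F2 a b a' b' x =
     (\<Sum>k. (pochhammer a k * pochhammer b k) / (pochhammer a' k * pochhammer b' k) * (x ^ k / fact k))"

definition bargmann_kernel :: "real \<Rightarrow> nat \<Rightarrow> complex \<Rightarrow> complex \<Rightarrow> complex" where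
  "bargmann_kernel \<nu> m z w =
     of_real (\<nu> / pi) *
       ((\<Sum>k<m. (of_real \<nu> * z * cnj w) ^ k / fact k) +
        (z * cnj w) ^ m / (Gamma (of_nat (m + 1)))\<^sup>2 *
          hypergeom_2F2 1 1 (of_nat (m + 1)) (of_nat (m + 1)) (of_real \<nu> * z * cnj w))"

text \<open>The series \<open>\<Sum>n\<ge>m\<close> is indexed by \<open>n = m + k\<close>, and its value may be infinite.\<close>

definition coeff_normsq :: "real \<Rightarrow> nat \<Rightarrow> (nat \<Rightarrow> complex) \<Rightarrow> ennreal" where
  "coeff_normsq \<nu> m a =
     ennreal pi *
       ((\<Sum>n<m. ennreal (fact n / \<nu> ^ (n + 1) * (cmod (a n))\<^sup>2)) +
        (\<Sum>k. ennreal ((fact (m + k))\<^sup>2 / (\<nu> ^ (k + 1) * fact k) * (cmod (a (m + k)))\<^sup>2)))"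

end

theory Submission
  imports Defs "HOL-Probability.Distributions"
begin

text \<open>
  Rotation invariance of Lebesgue measure makes the monomials orthogonal on every disc centred at
  the origin, so Parseval holds on discs (by uniform convergence of the power series there) and,
  letting the radius grow, on the plane; there the squared norm of \<open>z ^ n\<close> is a Gamma integral,
  because the image of Lebesgue measure under \<open>\<bar>z\<bar>\<^sup>2\<close> is \<open>\<pi>\<close> times Lebesgue measure on the half-line.
  Applied to \<open>f\<^sub>1\<close> and to the \<open>m\<close>-th derivative of \<open>f\<^sub>2\<close>, and polarized, this turns the
  Bargmann form into \<open>\<Sum>n. \<sigma> n * a n * cnj (b n)\<close>. For any positive weights such that
  \<open>\<Sum>n. x ^ n / \<sigma> n\<close> is entire, the entire functions with square-summable weighted coefficients
  form a reproducing kernel Hilbert space with kernel \<open>\<Sum>n. (z * cnj w) ^ n / \<sigma> n\<close>.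
\<close>

section \<open>Rotations and radial integrals in the plane\<close>

text \<open>A measure giving every box its volume is Lebesgue measure, and a box in the complex
  plane is a product of two open intervals. This opens the way to Tonelli's theorem in real
  coordinates.\<close>

lemma lborel_complex_eq_distr:
  "(lborel :: complex measure) = distr (lborel \<Otimes>\<^sub>M lborel) borel (\<lambda>(x, y). Complex x y)"
proof (rule lborel_eqI)
  have meas: "(\<lambda>(x, y). Complex x y) \<in> (lborel \<Otimes>\<^sub>M lborel) \<rightarrow>\<^sub>M (borel :: complex measure)"
    by (simp add: Complex_eq case_prod_beta)
  fix l u :: complex
  assume le: "\<And>b. b \<in> Basis \<Longrightarrow> l \<bullet> b \<le> u \<bullet> b"
  then have le': "Re l \<le> Re u" "Im l \<le> Im u"
    using le[of 1] le[of \<i>] by (auto simp: Basis_complex_def)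
  have "(\<lambda>(x, y). Complex x y) -` box l u \<inter> space (lborel \<Otimes>\<^sub>M lborel)
      = {Re l<..<Re u} \<times> {Im l<..<Im u}"
    by (auto simp: box_def Basis_complex_def space_pair_measure)
  then show "emeasure (distr (lborel \<Otimes>\<^sub>M lborel) borel (\<lambda>(x, y). Complex x y)) (box l u)
      = (\<Prod>b\<in>Basis. (u - l) \<bullet> b)"
    using le' meas
    by (simp add: emeasure_distr lborel.emeasure_pair_measure_Times Basis_complex_def
        ennreal_mult' complex_i_not_one[symmetric])
qed simp

lemma nn_integral_complex:
  fixes f :: "complex \<Rightarrow> ennreal"
  assumes [measurable]: "f \<in> borel_measurable borel"
  shows "(\<integral>\<^sup>+z. f z \<partial>lborel) = (\<integral>\<^sup>+x. \<integral>\<^sup>+y. f (Complex x y) \<partial>lborel \<partial>lborel)"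
proof -
  have [measurable]: "(\<lambda>(x, y). Complex x y) \<in> (lborel \<Otimes>\<^sub>M lborel) \<rightarrow>\<^sub>M (borel :: complex measure)"
    by (simp add: Complex_eq case_prod_beta)
  have "(\<integral>\<^sup>+z. f z \<partial>lborel) = (\<integral>\<^sup>+p. f (case p of (x, y) \<Rightarrow> Complex x y) \<partial>(lborel \<Otimes>\<^sub>M lborel))"
    by (subst lborel_complex_eq_distr, subst nn_integral_distr) auto
  also have "\<dots> = (\<integral>\<^sup>+x. \<integral>\<^sup>+y. f (Complex x y) \<partial>lborel \<partial>lborel)"
    by (subst lborel.nn_integral_fst[symmetric]) auto
  finally show ?thesis .
qed

lemma measurable_Complex [measurable (raw)]:
  assumes "f \<in> borel_measurable M" "g \<in> borel_measurable M"
  shows "(\<lambda>x. Complex (f x) (g x)) \<in> borel_measurable M"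
  using assms by (simp add: Complex_eq)

text \<open>For \<open>Re u \<noteq> 0\<close> the rotation is a composition of two affine maps, each acting on a single coordinate.\<close>

lemma nn_integral_mult_unit_aux:
  fixes f :: "complex \<Rightarrow> ennreal"
  assumes [measurable]: "f \<in> borel_measurable borel" and u: "cmod u = 1" and c: "Re u \<noteq> 0"
  shows "(\<integral>\<^sup>+z. f (u * z) \<partial>lborel) = (\<integral>\<^sup>+z. f z \<partial>lborel)"
proof -
  define c s where "c = Re u" and "s = Im u"
  have cs: "c * c + s * s = 1" and c0: "c \<noteq> 0"
    using u c by (auto simp: c_def s_def cmod_def power2_eq_square)
  have mult: "u * Complex x y = Complex (c * x - s * y) (s * x + c * y)" for x y
    by (simp add: complex_eq_iff c_def s_def)
  have "(\<integral>\<^sup>+z. f (u * z) \<partial>lborel)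
      = (\<integral>\<^sup>+x. \<integral>\<^sup>+y. f (Complex (c * x - s * y) (s * x + c * y)) \<partial>lborel \<partial>lborel)"
    by (subst nn_integral_complex) (auto simp: mult)
  also have "\<dots> = (\<integral>\<^sup>+y. \<integral>\<^sup>+x. f (Complex (c * x - s * y) (s * x + c * y)) \<partial>lborel \<partial>lborel)"
    by (rule lborel_pair.Fubini') simp
  \<comment> \<open>Substituting x = s*y/c + x'/c makes the first coordinate x'; the second becomes
    (s*x' + y)/c because c*c + s*s = 1. The Jacobian is 1/|c|.\<close>
  also have "\<dots> = (\<integral>\<^sup>+y. ennreal \<bar>1 / c\<bar> * (\<integral>\<^sup>+x. f (Complex x ((s * x + y) / c)) \<partial>lborel) \<partial>lborel)"
  proof (rule nn_integral_cong)
    fix y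
    have 1: "c * (s * y / c + 1 / c * x) - s * y = x" for x
      using c0 by (simp add: field_simps)
    have "s * (s * y / c + 1 / c * x) + c * y = (s * x + (c * c + s * s) * y) / c" for x
      using c0 by (simp add: field_simps)
    then have 2: "s * (s * y / c + 1 / c * x) + c * y = (s * x + y) / c" for x
      by (simp add: cs)
    show "(\<integral>\<^sup>+x. f (Complex (c * x - s * y) (s * x + c * y)) \<partial>lborel)
        = ennreal \<bar>1 / c\<bar> * (\<integral>\<^sup>+x. f (Complex x ((s * x + y) / c)) \<partial>lborel)"
      using c0 by (subst nn_integral_real_affine[where c = "1 / c" and t = "s * y / c"]) (simp_all add: 1 2 del: times_divide_eq_left abs_divide)
  qed
  also have "\<dots> = ennreal \<bar>1 / c\<bar> * (\<integral>\<^sup>+x. \<integral>\<^sup>+y. f (Complex x ((s * x + y) / c)) \<partial>lborel \<partial>lborel)"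
    by (subst nn_integral_cmult) (auto intro!: arg_cong2[where f = "(*)"] lborel_pair.Fubini')
  \<comment> \<open>The substitution y = c*y' - s*x undoes the remaining shear and scaling; its
    Jacobian |c| cancels the earlier 1/|c|.\<close>
  also have "(\<integral>\<^sup>+x. \<integral>\<^sup>+y. f (Complex x ((s * x + y) / c)) \<partial>lborel \<partial>lborel)
      = (\<integral>\<^sup>+x. ennreal \<bar>c\<bar> * (\<integral>\<^sup>+y. f (Complex x y) \<partial>lborel) \<partial>lborel)"
  proof (rule nn_integral_cong)
    fix x
    show "(\<integral>\<^sup>+y. f (Complex x ((s * x + y) / c)) \<partial>lborel)
        = ennreal \<bar>c\<bar> * (\<integral>\<^sup>+y. f (Complex x y) \<partial>lborel)"
      using c0 by (subst nn_integral_real_affine[where c = c and t = "- (s * x)"]) simp_all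
  qed
  also have "ennreal \<bar>1 / c\<bar> * \<dots> = (\<integral>\<^sup>+z. f z \<partial>lborel)"
    using c0 by (subst nn_integral_cmult)
      (simp_all add: nn_integral_complex mult.assoc[symmetric] ennreal_mult[symmetric] abs_mult[symmetric])
  finally show ?thesis .
qed

lemma nn_integral_mult_unit:
  fixes f :: "complex \<Rightarrow> ennreal"
  assumes [measurable]: "f \<in> borel_measurable borel" and u: "cmod u = 1"
  shows "(\<integral>\<^sup>+z. f (u * z) \<partial>lborel) = (\<integral>\<^sup>+z. f z \<partial>lborel)"
proof (cases "Re u = 0")
  case False
  with u show ?thesis
    by (intro nn_integral_mult_unit_aux) auto
next
  case True
  \<comment> \<open>Rotate twice by a square root v of u. If Re v were 0 as well, then Re u = 0
    would force Im v = 0, against |v| = 1, so the previous case applies to v.\<close>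
  define v where "v = csqrt u"
  have vv: "v * v = u"
    by (simp add: v_def flip: power2_eq_square)
  have v: "cmod v = 1"
    using u by (simp add: v_def)
  have "Re v \<noteq> 0"
  proof
    assume "Re v = 0"
    then have "Im v * Im v = 0"
      using True by (simp flip: vv)
    with \<open>Re v = 0\<close> v show False
      by (simp add: cmod_def)
  qed
  then have "(\<integral>\<^sup>+z. f (v * (v * z)) \<partial>lborel) = (\<integral>\<^sup>+z. f z \<partial>lborel)"
    using nn_integral_mult_unit_aux[of "\<lambda>z. f (v * z)" v] nn_integral_mult_unit_aux[of f v] v
    by simp
  then show ?thesis
    by (simp add: vv flip: mult.assoc)
qed

text \<open>Stating the invariance for the measure itself makes it usable for Bochner integrals of
  complex functions.\<close>

lemma distr_lborel_mult_unit:
  assumes u: "cmod u = 1"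
  shows "distr lborel borel ((*) u) = (lborel :: complex measure)"
proof (rule measure_eqI)
  fix A :: "complex set"
  assume "A \<in> sets (distr lborel borel ((*) u))"
  then have [measurable]: "A \<in> sets borel" by simp
  have "emeasure (distr lborel borel ((*) u)) A = (\<integral>\<^sup>+z. indicator A (u * z) \<partial>lborel)"
    by (subst nn_integral_indicator[symmetric], simp, subst nn_integral_distr) auto
  also have "\<dots> = emeasure lborel A"
    using nn_integral_mult_unit[OF _ u, of "indicator A"] by simp
  finally show "emeasure (distr lborel borel ((*) u)) A = emeasure lborel A" .
qed simp

section \<open>Pushforward under the squared modulus and Gaussian moments\<close>

text \<open>The sign makes the half-lines \<open>{x<..}\<close> used by \<open>measure_eqI_lessThan\<close> have finite measure.\<close>

lemma distr_lborel_norm_sq: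
  assumes "\<nu> > 0"
  shows "distr lborel borel (\<lambda>z :: complex. - (\<nu> * (cmod z)\<^sup>2))
    = density lborel (\<lambda>t. ennreal (pi / \<nu>) * indicator {..0} t)" (is "?D = ?E")
proof (rule measure_eqI_lessThan)
  fix x :: real
  have E: "emeasure ?E {x<..} = ennreal (pi / \<nu> * max 0 (- x))"
  proof -
    have "emeasure ?E {x<..} = (\<integral>\<^sup>+t. ennreal (pi / \<nu>) * indicator {x<..0} t \<partial>lborel)"
      by (subst emeasure_density) (auto intro!: nn_integral_cong split: split_indicator)
    also have "\<dots> = ennreal (pi / \<nu>) * emeasure lborel {x<..0}"
      by (subst nn_integral_cmult_indicator) simp_all
    also have "\<dots> = ennreal (pi / \<nu> * max 0 (- x))"
      using assms by (cases "x \<le> 0") (simp_all add: ennreal_mult[symmetric])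
    finally show ?thesis .
  qed
  have D: "emeasure ?D {x<..} = ennreal (pi / \<nu> * max 0 (- x))"
  proof -
    \<comment> \<open>This holds for every real x: \<open>sqrt\<close> is strictly increasing on all
      reals and negative on negative arguments, so for x >= 0 the ball below has nonpositive radius
      and is empty.\<close>
    have *: "- (\<nu> * (cmod z)\<^sup>2) > x \<longleftrightarrow> cmod z < sqrt (- x / \<nu>)" for z
    proof -
      have "- (\<nu> * (cmod z)\<^sup>2) > x \<longleftrightarrow> (cmod z)\<^sup>2 < - x / \<nu>"
        using assms by (simp add: field_simps) linarith
      then show ?thesis
        using real_sqrt_less_iff[of "(cmod z)\<^sup>2" "- x / \<nu>"] by simp
    qed
    have "emeasure ?D {x<..} = emeasure lborel {z. - (\<nu> * (cmod z)\<^sup>2) > x}"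
      by (subst emeasure_distr) (auto intro!: arg_cong[where f = "emeasure lborel"])
    also have "{z. - (\<nu> * (cmod z)\<^sup>2) > x} = ball 0 (sqrt (- x / \<nu>))"
      unfolding * by auto
    also have "emeasure lborel (ball (0 :: complex) (sqrt (- x / \<nu>))) = ennreal (pi / \<nu> * max 0 (- x))"
    proof (cases "x < 0")
      case True
      then have "- x / \<nu> \<ge> 0"
        using assms by (simp add: divide_nonpos_pos)
      then have "emeasure lborel (ball (0 :: complex) (sqrt (- x / \<nu>))) = ennreal (pi * (- x / \<nu>))"
        by (subst emeasure_ball) (simp_all add: unit_ball_vol_2)
      with True show ?thesis by simp
    next
      case False
      then have "sqrt (- x / \<nu>) \<le> 0"
        using assms by simp
      then have empty: "ball (0 :: complex) (sqrt (- x / \<nu>)) = {}"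
        by simp
      show ?thesis
        unfolding empty using False by simp
    qed
    finally show ?thesis .
  qed
  show "emeasure ?D {x<..} = emeasure ?E {x<..}"
    unfolding D E ..
  show "emeasure ?D {x<..} < \<infinity>"
    unfolding D by simp
qed simp_all

text \<open>The integrand is a function of t = -nu*|z|^2 alone, so
  \<open>distr_lborel_norm_sq\<close> reduces it to pi/nu times the integral of (-t/nu)^n * exp t
  over t <= 0. Reflection turns this into the Gamma integral for n!.\<close>

lemma gaussian_moment:
  assumes "\<nu> > 0"
  shows "(\<integral>\<^sup>+z. ennreal ((cmod z) ^ (2 * n) * exp (- \<nu> * (cmod z)\<^sup>2)) \<partial>lborel)
    = ennreal (pi * fact n / \<nu> ^ (n + 1))"
proof -
  have "(\<integral>\<^sup>+z. ennreal ((cmod z) ^ (2 * n) * exp (- \<nu> * (cmod z)\<^sup>2)) \<partial>lborel)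
      = (\<integral>\<^sup>+z. ennreal ((- (- (\<nu> * (cmod z)\<^sup>2)) / \<nu>) ^ n * exp (- (\<nu> * (cmod z)\<^sup>2))) \<partial>lborel)"
    using assms by (intro nn_integral_cong) (simp add: power_mult)
  also have "\<dots> = (\<integral>\<^sup>+t. ennreal ((- t / \<nu>) ^ n * exp t)
      \<partial>distr lborel borel (\<lambda>z :: complex. - (\<nu> * (cmod z)\<^sup>2)))"
    by (subst nn_integral_distr) auto
  also have "\<dots> = (\<integral>\<^sup>+t. ennreal (pi / \<nu>) * indicator {..0} t * ennreal ((- t / \<nu>) ^ n * exp t) \<partial>lborel)"
    by (simp add: distr_lborel_norm_sq assms nn_integral_density)
  also have "\<dots> = (\<integral>\<^sup>+t. ennreal (pi / \<nu>) * indicator {..0} (- t) * ennreal ((t / \<nu>) ^ n * exp (- t)) \<partial>lborel)"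
    by (subst nn_integral_real_affine[where c = "- 1" and t = 0]) auto
  also have "\<dots> = (\<integral>\<^sup>+t. ennreal (pi / \<nu> ^ (n + 1)) * (ennreal (t ^ n * exp (- t)) * indicator {0..} t) \<partial>lborel)"
    using assms by (intro nn_integral_cong)
      (auto simp: power_divide ennreal_mult[symmetric] split: split_indicator)
  also have "\<dots> = ennreal (pi / \<nu> ^ (n + 1)) * ennreal (fact n)"
    by (subst nn_integral_cmult) (simp_all add: nn_intergal_power_times_exp_Ici)
  also have "\<dots> = ennreal (pi * fact n / \<nu> ^ (n + 1))"
    using assms by (simp add: ennreal_mult[symmetric])
  finally show ?thesis .
qed

section \<open>Taylor coefficients of entire functions\<close>

lemma taylor_coeff_conv_deriv: "taylor_coeff f n = (deriv ^^ n) f 0 / fact n"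
  by (simp add: taylor_coeff_def fps_expansion_def)

lemma taylor_coeff_sums:
  assumes "f holomorphic_on UNIV"
  shows "(\<lambda>n. taylor_coeff f n * z ^ n) sums f z"
  using holomorphic_power_series[of f 0 "norm z + 1" z] holomorphic_on_subset[OF assms]
  by (simp add: taylor_coeff_conv_deriv)

lemma power_series_entire:
  assumes "\<And>z :: complex. (\<lambda>n. a n * z ^ n) sums f z"
  shows "f holomorphic_on UNIV"
proof -
  have "f holomorphic_on ball 0 r" for r
    using assms by (intro power_series_holomorphic[where a = a]) simp
  then show ?thesis
    by (metis holomorphic_on_open open_ball open_UNIV UNIV_I mem_ball_0 less_add_one)
qed

text \<open>Uniqueness of coefficients: exhibiting any everywhere convergent series for a function
  determines its \<open>taylor_coeff\<close>. Sums, multiples and truncations are all treated this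
  way below.\<close>

lemma taylor_coeff_power_series:
  assumes "\<And>z :: complex. (\<lambda>n. a n * z ^ n) sums f z"
  shows "taylor_coeff f = a"
proof
  fix n
  define F where "F = Abs_fps a"
  have "conv_radius a = \<infinity>"
    using assms by (intro conv_radius_inftyI'') (auto intro: sums_summable)
  then have "fps_conv_radius F > 0"
    by (simp add: fps_conv_radius_def F_def)
  moreover have "eval_fps F = f"
    using assms by (auto simp: eval_fps_def F_def sums_iff)
  ultimately have "fps_nth F n = (deriv ^^ n) f 0 / fact n"
    using fps_nth_conv_deriv[of F n] by simp
  then show "taylor_coeff f n = a n"
    by (simp add: F_def taylor_coeff_conv_deriv)
qed

text \<open>Both sides are the derivative of f of order m + k at 0, divided by k!.\<close>

lemma taylor_coeff_deriv_funpow: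
  "taylor_coeff ((deriv ^^ m) f) k = fact (m + k) / fact k * taylor_coeff f (m + k)"
  by (simp add: taylor_coeff_conv_deriv add.commute flip: funpow_add[THEN fun_cong, unfolded o_def])

lemma taylor_coeff_add:
  assumes "f holomorphic_on UNIV" "g holomorphic_on UNIV"
  shows "taylor_coeff (\<lambda>z. f z + g z) n = taylor_coeff f n + taylor_coeff g n"
proof -
  have "taylor_coeff (\<lambda>z. f z + g z) = (\<lambda>n. taylor_coeff f n + taylor_coeff g n)"
    by (rule taylor_coeff_power_series)
      (use sums_add[OF taylor_coeff_sums[OF assms(1)] taylor_coeff_sums[OF assms(2)]] in
        \<open>simp add: algebra_simps\<close>)
  then show ?thesis by simp
qed

lemma taylor_coeff_mult_const:
  assumes "f holomorphic_on UNIV"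
  shows "taylor_coeff (\<lambda>z. c * f z) n = c * taylor_coeff f n"
proof -
  have "taylor_coeff (\<lambda>z. c * f z) = (\<lambda>n. c * taylor_coeff f n)"
    by (rule taylor_coeff_power_series)
      (use sums_mult[OF taylor_coeff_sums[OF assms]] in \<open>simp add: algebra_simps\<close>)
  then show ?thesis by simp
qed

section \<open>Parseval's formula for the Gaussian weight\<close>

lemma integral_mult_unit:
  fixes f :: "complex \<Rightarrow> complex"
  assumes "cmod u = 1" and [measurable]: "f \<in> borel_measurable borel"
  shows "(LINT z|lborel. f (u * z)) = (LINT z|lborel. f z)"
proof -
  have "(LINT z|lborel. f z) = (LINT z|distr lborel borel ((*) u). f z)"
    by (simp add: distr_lborel_mult_unit assms)
  also have "\<dots> = (LINT z|lborel. f (u * z))"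
    by (subst integral_distr) auto
  finally show ?thesis by simp
qed

lemma integrable_monomial_cball:
  "integrable lborel (\<lambda>z :: complex. indicator (cball 0 R) z *\<^sub>R
     (z ^ i * cnj (z ^ j) * of_real (exp (- \<nu> * (cmod z)\<^sup>2))))"
  by (rule borel_integrable_compact) (auto intro!: continuous_intros)

text \<open>Rotation by the angle pi/(i - j) preserves the disc, the weight and the measure, but
  multiplies z^i * cnj(z^j) by cis pi = -1. The integral therefore equals its own negative.\<close>

lemma monomial_orthogonal:
  assumes "i \<noteq> j"
  shows "(LINT z|lborel. indicator (cball 0 R) z *\<^sub>R
    (z ^ i * cnj (z ^ j) * of_real (exp (- \<nu> * (cmod z)\<^sup>2)))) = (0 :: complex)"
proof -
  define F :: "complex \<Rightarrow> complex" where
    "F z = indicator (cball 0 R) z *\<^sub>R (z ^ i * cnj (z ^ j) * of_real (exp (- \<nu> * (cmod z)\<^sup>2)))" for z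
  define u where "u = cis (pi / (real i - real j))"
  have u: "cmod u = 1" by (simp add: u_def)
  have "u ^ i * cnj (u ^ j) = cis (real i * (pi / (real i - real j)) + - (real j * (pi / (real i - real j))))"
    by (simp only: u_def Complex.DeMoivre cis_cnj cis_mult)
  also have "real i * (pi / (real i - real j)) + - (real j * (pi / (real i - real j))) = pi"
  proof -
    have "real i * (pi / (real i - real j)) + - (real j * (pi / (real i - real j)))
        = (real i - real j) * (pi / (real i - real j))"
      by (simp add: left_diff_distrib diff_divide_distrib)
    with assms show ?thesis by simp
  qed
  finally have uu: "u ^ i * cnj (u ^ j) = - 1" by simp
  have "F (u * z) = - F z" for z
  proof -
    have "F (u * z) = (u ^ i * cnj (u ^ j)) * F z"
      by (simp add: F_def u norm_mult power_mult_distrib indicator_def)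
    then show ?thesis unfolding uu by simp
  qed
  moreover have "F \<in> borel_measurable borel"
    using borel_measurable_integrable[OF integrable_monomial_cball[of R i j \<nu>]] by (simp add: F_def[abs_def])
  ultimately have "(LINT z|lborel. F z) = - (LINT z|lborel. F z)"
    using integral_mult_unit[OF u, of F] by simp
  then show ?thesis by (simp add: F_def[abs_def])
qed

text \<open>On the disc the partial sums are uniformly bounded and converge to g, so dominated
  convergence reduces the claim to polynomials, where orthogonality applies. The series stays under
  the integral so that both sides can be exhausted by discs in the same way.\<close>

lemma parseval_cball:
  fixes b :: "nat \<Rightarrow> complex"
  assumes b: "\<And>z. (\<lambda>n. b n * z ^ n) sums g z" and R: "R \<ge> 0"
  shows "(\<integral>\<^sup>+z. ennreal ((cmod (g z))\<^sup>2 * exp (- \<nu> * (cmod z)\<^sup>2)) * indicator (cball 0 R) z \<partial>lborel)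
    = (\<integral>\<^sup>+z. (\<Sum>n. ennreal ((cmod (b n))\<^sup>2 * (cmod z ^ (2 * n) * exp (- \<nu> * (cmod z)\<^sup>2))))
         * indicator (cball 0 R) z \<partial>lborel)"
proof -
  define W where "W z = exp (- \<nu> * (cmod z)\<^sup>2)" for z
  define I where "I z = (indicator (cball 0 R) z :: real)" for z :: complex
  define s where "s N z = (\<Sum>n<N. b n * z ^ n)" for N z
  have int_c: "integrable lborel (\<lambda>z. I z *\<^sub>R (z ^ i * cnj (z ^ j) * of_real (W z)))" for i j
    unfolding W_def I_def by (rule integrable_monomial_cball)
  have int_n: "integrable lborel (\<lambda>z. I z * (cmod z ^ (2 * n) * W z))" for n
  proof -
    have "integrable lborel (\<lambda>z :: complex. indicator (cball 0 R) z *\<^sub>R (cmod z ^ (2 * n) * W z))"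
      unfolding W_def by (rule borel_integrable_compact) (auto intro!: continuous_intros)
    then show ?thesis by (simp add: I_def)
  qed
  have [measurable]: "s N \<in> borel_measurable borel" for N
    unfolding s_def by (auto intro!: borel_measurable_continuous_onI continuous_intros)
  have lim: "(\<lambda>N. s N z) \<longlonglongrightarrow> g z" for z
    using b[of z] by (simp add: sums_def s_def)
  have [measurable]: "g \<in> borel_measurable borel"
    using lim by (rule borel_measurable_LIMSEQ_metric[rotated]) simp
  have [measurable]: "W \<in> borel_measurable borel" "I \<in> borel_measurable borel"
    unfolding W_def[abs_def] I_def[abs_def] by (simp_all add: borel_measurable_indicator)
  define C where "C = (\<Sum>n. cmod (b n) * R ^ n)"
  \<comment> \<open>Convergence at R + 1 gives absolute convergence at R, so C is a genuine bound
    for all partial sums on the disc.\<close>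
  have "summable (\<lambda>n. norm (b n * of_real R ^ n))"
    using b[of "of_real (R + 1)", THEN sums_summable] R
    by (intro powser_insidea[where x = "of_real (R + 1)"]) auto
  then have summ: "summable (\<lambda>n. cmod (b n) * R ^ n)"
    using R by (simp add: norm_mult norm_power)
  have bound: "cmod (s N z) \<le> C" if "cmod z \<le> R" for N z
  proof -
    have "cmod (s N z) \<le> (\<Sum>n<N. cmod (b n) * cmod z ^ n)"
      unfolding s_def by (rule order_trans[OF norm_sum]) (simp add: norm_mult norm_power)
    also have "\<dots> \<le> (\<Sum>n<N. cmod (b n) * R ^ n)"
      by (intro sum_mono mult_left_mono power_mono that) auto
    also have "\<dots> \<le> C"
      unfolding C_def using summ R by (intro sum_le_suminf) auto
    finally show ?thesis .
  qed
  \<comment> \<open>The factor \<open>cmod z ^ (2 * 0)\<close> is 1; in this form the dominating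
    function is a multiple of the case n = 0 of \<open>int_n\<close>.\<close>
  have dom: "norm (I z * ((cmod (s N z))\<^sup>2 * W z)) \<le> C\<^sup>2 * (I z * (cmod z ^ (2 * 0) * W z))" for N z
    using bound[of z N]
    by (auto simp: I_def W_def indicator_def intro!: mult_right_mono power_mono)
  have lim2: "(\<lambda>N. I z * ((cmod (s N z))\<^sup>2 * W z)) \<longlonglongrightarrow> I z * ((cmod (g z))\<^sup>2 * W z)" for z
    by (intro tendsto_intros lim)
  have C_int: "integrable lborel (\<lambda>z. C\<^sup>2 * (I z * (cmod z ^ (2 * 0) * W z)))"
    by (intro integrable_mult_right int_n)
  have dc: "integrable lborel (\<lambda>z. I z * ((cmod (g z))\<^sup>2 * W z))"
    "(\<lambda>N. LINT z|lborel. I z * ((cmod (s N z))\<^sup>2 * W z)) \<longlonglongrightarrow> (LINT z|lborel. I z * ((cmod (g z))\<^sup>2 * W z))"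
    by (rule integrable_dominated_convergence[OF _ _ C_int AE_I2[OF lim2] AE_I2[OF dom]]
        integral_dominated_convergence[OF _ _ C_int AE_I2[OF lim2] AE_I2[OF dom]]; measurable)+
  \<comment> \<open>Expand the squared modulus of the partial sum as a double sum; only the diagonal
    terms survive integration.\<close>
  have fin: "(LINT z|lborel. I z * ((cmod (s N z))\<^sup>2 * W z))
      = (\<Sum>n<N. (cmod (b n))\<^sup>2 * (LINT z|lborel. I z * (cmod z ^ (2 * n) * W z)))" for N
  proof -
    have diag: "(LINT z|lborel. I z *\<^sub>R (z ^ i * cnj (z ^ j) * of_real (W z)))
        = (if i = j then of_real (LINT z|lborel. I z * (cmod z ^ (2 * i) * W z)) else 0)" for i j
    proof (cases "i = j")
      case True
      have "z ^ i * cnj (z ^ i) = of_real (cmod z ^ (2 * i))" for z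
        by (simp only: complex_norm_square[symmetric] norm_power power_mult mult.commute[of 2] of_real_power)
      with True show ?thesis
        by (simp add: scaleR_conv_of_real flip: of_real_mult of_real_power)
    next
      case False
      then show ?thesis
        using monomial_orthogonal[OF False, of R \<nu>] by (simp add: I_def W_def)
    qed
    have "complex_of_real (LINT z|lborel. I z * ((cmod (s N z))\<^sup>2 * W z))
        = (LINT z|lborel. complex_of_real (I z * ((cmod (s N z))\<^sup>2 * W z)))"
      by (rule integral_complex_of_real[symmetric])
    also have "\<dots> = (LINT z|lborel. (\<Sum>i<N. \<Sum>j<N. (b i * cnj (b j)) *
        (I z *\<^sub>R (z ^ i * cnj (z ^ j) * of_real (W z)))))"
    proof (rule Bochner_Integration.integral_cong[OF refl])
      fix z
      have "complex_of_real (I z * ((cmod (s N z))\<^sup>2 * W z))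
          = of_real (I z) * of_real (W z) * (s N z * cnj (s N z))"
        by (simp add: complex_norm_square[symmetric])
      also have "s N z * cnj (s N z) = (\<Sum>i<N. \<Sum>j<N. (b i * z ^ i) * cnj (b j * z ^ j))"
        by (simp add: s_def sum_product)
      finally show "complex_of_real (I z * ((cmod (s N z))\<^sup>2 * W z)) = (\<Sum>i<N. \<Sum>j<N. (b i * cnj (b j)) *
        (I z *\<^sub>R (z ^ i * cnj (z ^ j) * of_real (W z))))"
        by (simp add: sum_distrib_left scaleR_conv_of_real mult_ac)
    qed
    also have "\<dots> = (\<Sum>i<N. \<Sum>j<N. (b i * cnj (b j)) *
        (LINT z|lborel. I z *\<^sub>R (z ^ i * cnj (z ^ j) * of_real (W z))))"
      by (subst Bochner_Integration.integral_sum, (intro Bochner_Integration.integrable_sum integrable_mult_right int_c)[1],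
          subst Bochner_Integration.integral_sum, (intro integrable_mult_right int_c)[1], subst integral_mult_right_zero, rule refl)
    also have "\<dots> = (\<Sum>i<N. of_real ((cmod (b i))\<^sup>2 * (LINT z|lborel. I z * (cmod z ^ (2 * i) * W z))))"
      unfolding diag by (intro sum.cong refl) (simp add: if_distrib sum.delta' complex_norm_square[symmetric] cong: if_cong)
    finally show ?thesis
      by (simp only: of_real_sum[symmetric] of_real_eq_iff)
  qed
  have sums: "(\<lambda>n. (cmod (b n))\<^sup>2 * (LINT z|lborel. I z * (cmod z ^ (2 * n) * W z)))
      sums (LINT z|lborel. I z * ((cmod (g z))\<^sup>2 * W z))"
    using dc(2) by (simp add: sums_def fin)
  have nonneg: "0 \<le> (cmod (b n))\<^sup>2 * (LINT z|lborel. I z * (cmod z ^ (2 * n) * W z))" for n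
    by (auto simp: I_def W_def intro!: mult_nonneg_nonneg integral_nonneg_AE)
  have "(\<integral>\<^sup>+z. ennreal ((cmod (g z))\<^sup>2 * W z) * indicator (cball 0 R) z \<partial>lborel)
      = (\<integral>\<^sup>+z. ennreal (I z * ((cmod (g z))\<^sup>2 * W z)) \<partial>lborel)"
    by (intro nn_integral_cong) (simp add: I_def indicator_def)
  also have "\<dots> = ennreal (LINT z|lborel. I z * ((cmod (g z))\<^sup>2 * W z))"
    by (intro nn_integral_eq_integral dc) (simp add: I_def W_def)
  also have "\<dots> = (\<Sum>n. ennreal ((cmod (b n))\<^sup>2 * (LINT z|lborel. I z * (cmod z ^ (2 * n) * W z))))"
    using sums nonneg by (simp add: sums_iff suminf_ennreal2)
  also have "\<dots> = (\<Sum>n. \<integral>\<^sup>+z. ennreal ((cmod (b n))\<^sup>2 * (I z * (cmod z ^ (2 * n) * W z))) \<partial>lborel)"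
    by (subst nn_integral_eq_integral[OF integrable_mult_right[OF int_n]]) (simp_all add: I_def W_def)
  also have "\<dots> = (\<integral>\<^sup>+z. (\<Sum>n. ennreal ((cmod (b n))\<^sup>2 * (I z * (cmod z ^ (2 * n) * W z)))) \<partial>lborel)"
    by (subst nn_integral_suminf) auto
  also have "\<dots> = (\<integral>\<^sup>+z. (\<Sum>n. ennreal ((cmod (b n))\<^sup>2 * (cmod z ^ (2 * n) * W z)))
      * indicator (cball 0 R) z \<partial>lborel)"
    by (intro nn_integral_cong) (simp add: I_def indicator_def)
  finally show ?thesis by (simp add: W_def)
qed

text \<open>Discs of integer radius exhaust the plane, so monotone convergence carries identities
  from discs to the plane.\<close>

lemma nn_integral_SUP_cball:
  fixes F :: "complex \<Rightarrow> ennreal"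
  assumes [measurable]: "F \<in> borel_measurable borel"
  shows "(\<integral>\<^sup>+z. F z \<partial>lborel) = (SUP k. \<integral>\<^sup>+z. F z * indicator (cball 0 (real k)) z \<partial>lborel)"
proof -
  have "F z = (SUP k. F z * indicator (cball 0 (real k)) z)" for z
  proof (rule antisym)
    obtain k where "cmod z \<le> real k" using real_arch_simple by blast
    then show "F z \<le> (SUP k. F z * indicator (cball 0 (real k)) z)"
      by (intro SUP_upper2[of k]) auto
    show "(SUP k. F z * indicator (cball 0 (real k)) z) \<le> F z"
      by (rule SUP_least) (auto split: split_indicator)
  qed
  then have "(\<integral>\<^sup>+z. F z \<partial>lborel) = (\<integral>\<^sup>+z. (SUP k. F z * indicator (cball 0 (real k)) z) \<partial>lborel)"
    by simp
  also have "\<dots> = (SUP k. \<integral>\<^sup>+z. F z * indicator (cball 0 (real k)) z \<partial>lborel)"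
    by (rule nn_integral_monotone_convergence_SUP)
      (auto intro!: borel_measurable_times_ennreal borel_measurable_indicator assms simp: incseq_def le_fun_def split: split_indicator)
  finally show ?thesis .
qed

text \<open>Let the radius grow in \<open>parseval_cball\<close>, exchange sum and integral, and
  evaluate each term by \<open>gaussian_moment\<close>. Both sides may be infinite, so the formula
  also serves as a membership criterion.\<close>

lemma gauss_normsq_power_series:
  fixes b :: "nat \<Rightarrow> complex"
  assumes b: "\<And>z. (\<lambda>n. b n * z ^ n) sums g z" and \<nu>: "\<nu> > 0"
  shows "gauss_normsq \<nu> g = (\<Sum>n. ennreal (pi * fact n / \<nu> ^ (n + 1) * (cmod (b n))\<^sup>2))"
proof -
  have [measurable]: "g \<in> borel_measurable borel"
    using power_series_entire[OF b]
    by (intro borel_measurable_continuous_onI holomorphic_on_imp_continuous_on)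
  have "gauss_normsq \<nu> g
    = (\<integral>\<^sup>+z. (\<Sum>n. ennreal ((cmod (b n))\<^sup>2 * (cmod z ^ (2 * n) * exp (- \<nu> * (cmod z)\<^sup>2)))) \<partial>lborel)"
    unfolding gauss_normsq_def
    by (subst (1 2) nn_integral_SUP_cball) (simp_all only: parseval_cball[OF b] of_nat_0_le_iff, simp_all)
  also have "\<dots> = (\<Sum>n. ennreal ((cmod (b n))\<^sup>2) *
      (\<integral>\<^sup>+z. ennreal (cmod z ^ (2 * n) * exp (- \<nu> * (cmod z)\<^sup>2)) \<partial>lborel))"
    by (simp add: nn_integral_suminf nn_integral_cmult ennreal_mult')
  also have "\<dots> = (\<Sum>n. ennreal (pi * fact n / \<nu> ^ (n + 1) * (cmod (b n))\<^sup>2))"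
    using \<nu> by (simp only: gaussian_moment) (simp add: ennreal_mult'[symmetric] mult.commute)
  finally show ?thesis .
qed

section \<open>From norms to inner products by polarization\<close>

text \<open>Turns an identity between extended nonnegative values into integrability and a
  convergent real series, which can then be combined with complex coefficients.\<close>

lemma nonneg_sums_if_nn_integral_eq_suminf:
  assumes "f \<in> borel_measurable M" "\<And>x. 0 \<le> f x" "\<And>n. 0 \<le> c n"
    and eq: "(\<integral>\<^sup>+x. ennreal (f x) \<partial>M) = (\<Sum>n. ennreal (c n))" and fin: "(\<integral>\<^sup>+x. ennreal (f x) \<partial>M) < \<infinity>"
  shows "integrable M f" "c sums (LINT x|M. f x)"
proof -
  show int: "integrable M f"
    using assms by (intro integrableI_nonneg) auto
  have "(\<Sum>n. ennreal (c n)) \<noteq> top"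
    using eq fin by simp
  then have summ: "summable c"
    using assms(3) by (intro summable_suminf_not_top)
  have "ennreal (LINT x|M. f x) = ennreal (\<Sum>n. c n)"
    using nn_integral_eq_integral[OF int] assms summ by (simp add: suminf_ennreal2)
  then have "(LINT x|M. f x) = (\<Sum>n. c n)"
    using assms summ by (simp add: suminf_nonneg)
  with summ show "c sums (LINT x|M. f x)"
    by (simp add: sums_iff)
qed

text \<open>Apply the norm formula to f + u*g for u = 1, -1, \<i>, -\<i>. The same polarization
  identity, used pointwise for the values and termwise for the coefficients, recovers four times
  each side.\<close>

lemma gauss_ip_sums:
  assumes hol: "f holomorphic_on UNIV" "g holomorphic_on UNIV" and \<nu>: "\<nu> > 0"
    and fin: "gauss_normsq \<nu> f < \<infinity>" "gauss_normsq \<nu> g < \<infinity>"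
  shows "(\<lambda>n. of_real (pi * fact n / \<nu> ^ (n + 1)) * taylor_coeff f n * cnj (taylor_coeff g n))
    sums gauss_ip \<nu> f g"
proof -
  define c where "c n = pi * fact n / \<nu> ^ (n + 1)" for n :: nat
  define h where "h u z = f z + u * g z" for u z
  define q where "q u z = (cmod (h u z))\<^sup>2 * exp (- \<nu> * (cmod z)\<^sup>2)" for u z
  define p where "p u n = c n * (cmod (taylor_coeff f n + u * taylor_coeff g n))\<^sup>2" for u n
  have c: "c n \<ge> 0" for n using \<nu> by (simp add: c_def)
  have [measurable]: "f \<in> borel_measurable borel" "g \<in> borel_measurable borel"
    using hol by (auto intro!: borel_measurable_continuous_onI holomorphic_on_imp_continuous_on)
  have meas_q: "q u \<in> borel_measurable lborel" for u
    unfolding q_def h_def by simp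
  have q_nonneg: "q u z \<ge> 0" for u z by (simp add: q_def)
  have p_nonneg: "p u n \<ge> 0" for u n by (simp add: p_def c)
  have hol_h: "h u holomorphic_on UNIV" for u
    unfolding h_def using hol by (intro holomorphic_intros)
  have nn: "(\<integral>\<^sup>+z. ennreal (q u z) \<partial>lborel) = (\<Sum>n. ennreal (p u n))" for u
  proof -
    have "taylor_coeff (h u) n = taylor_coeff f n + u * taylor_coeff g n" for n
      unfolding h_def using hol by (simp add: taylor_coeff_add taylor_coeff_mult_const holomorphic_on_mult)
    then show ?thesis
      using gauss_normsq_power_series[OF taylor_coeff_sums[OF hol_h] \<nu>, of u]
      by (simp add: gauss_normsq_def q_def p_def c_def)
  qed
  have fin_q: "(\<integral>\<^sup>+z. ennreal (q u z) \<partial>lborel) < \<infinity>" if "cmod u = 1" for u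
  proof -
    \<comment> \<open>Finiteness for f + u*g comes from (x + y)^2 <= 2*x^2 + 2*y^2.\<close>
    have "q u z \<le> 2 * ((cmod (f z))\<^sup>2 * exp (- \<nu> * (cmod z)\<^sup>2)) + 2 * ((cmod (g z))\<^sup>2 * exp (- \<nu> * (cmod z)\<^sup>2))" for z
    proof -
      have "cmod (h u z) \<le> cmod (f z) + cmod (g z)"
        unfolding h_def using norm_triangle_ineq[of "f z" "u * g z"] that by (simp add: norm_mult)
      then have "(cmod (h u z))\<^sup>2 \<le> (cmod (f z) + cmod (g z))\<^sup>2"
        by (intro power_mono) auto
      also have "\<dots> \<le> 2 * (cmod (f z))\<^sup>2 + 2 * (cmod (g z))\<^sup>2"
        using sum_squares_bound[of "cmod (f z)" "cmod (g z)"] by (simp add: power2_sum)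
      finally show ?thesis
        by (simp add: q_def flip: mult.assoc distrib_right)
    qed
    then have "(\<integral>\<^sup>+z. ennreal (q u z) \<partial>lborel)
        \<le> (\<integral>\<^sup>+z. 2 * ennreal ((cmod (f z))\<^sup>2 * exp (- \<nu> * (cmod z)\<^sup>2))
              + 2 * ennreal ((cmod (g z))\<^sup>2 * exp (- \<nu> * (cmod z)\<^sup>2)) \<partial>lborel)"
      by (intro nn_integral_mono) (simp add: ennreal_mult'[symmetric] ennreal_plus[symmetric] ennreal_leI
          flip: ennreal_numeral del: ennreal_plus)
    also have "\<dots> = 2 * gauss_normsq \<nu> f + 2 * gauss_normsq \<nu> g"
      unfolding gauss_normsq_def by (subst nn_integral_add) (auto simp: nn_integral_cmult)
    also have "\<dots> < \<infinity>"
      using fin by (simp add: ennreal_mult_less_top)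
    finally show ?thesis .
  qed
  have *: "integrable lborel (q u)" "p u sums (LINT z|lborel. q u z)" if "cmod u = 1" for u
    using nonneg_sums_if_nn_integral_eq_suminf[OF meas_q q_nonneg p_nonneg nn fin_q[OF that]]
    by auto
  \<comment> \<open>The factor \<open>1 * y\<close> is written out so that the four squares match
    \<open>p u n\<close> and \<open>q u z\<close> literally after unfolding.\<close>
  have polar: "4 * (x * cnj y) = of_real ((cmod (x + 1 * y))\<^sup>2) - of_real ((cmod (x + (- 1) * y))\<^sup>2)
      + \<i> * of_real ((cmod (x + \<i> * y))\<^sup>2) - \<i> * of_real ((cmod (x + (- \<i>) * y))\<^sup>2)" for x y
    unfolding complex_norm_square by (simp add: algebra_simps)
  have S: "(\<lambda>n. of_real (p 1 n) - of_real (p (- 1) n) + \<i> * of_real (p \<i> n) - \<i> * of_real (p (- \<i>) n))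
      sums (of_real (LINT z|lborel. q 1 z) - of_real (LINT z|lborel. q (- 1) z)
        + \<i> * of_real (LINT z|lborel. q \<i> z) - \<i> * of_real (LINT z|lborel. q (- \<i>) z))"
    by (intro sums_add sums_diff sums_mult sums_of_real *) auto
  have "(\<lambda>n. of_real (p 1 n) - of_real (p (- 1) n) + \<i> * of_real (p \<i> n) - \<i> * of_real (p (- \<i>) n))
      = (\<lambda>n. 4 * (of_real (c n) * taylor_coeff f n * cnj (taylor_coeff g n)))"
  proof
    fix n
    have "4 * (of_real (c n) * taylor_coeff f n * cnj (taylor_coeff g n))
        = of_real (c n) * (4 * (taylor_coeff f n * cnj (taylor_coeff g n)))"
      by simp
    then show "of_real (p 1 n) - of_real (p (- 1) n) + \<i> * of_real (p \<i> n) - \<i> * of_real (p (- \<i>) n)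
        = 4 * (of_real (c n) * taylor_coeff f n * cnj (taylor_coeff g n))"
      unfolding polar p_def by (simp add: algebra_simps)
  qed
  moreover have "4 * gauss_ip \<nu> f g = of_real (LINT z|lborel. q 1 z) - of_real (LINT z|lborel. q (- 1) z)
        + \<i> * of_real (LINT z|lborel. q \<i> z) - \<i> * of_real (LINT z|lborel. q (- \<i>) z)"
  proof -
    have "4 * (f z * cnj (g z) * of_real (exp (- \<nu> * (cmod z)\<^sup>2)))
        = of_real (q 1 z) - of_real (q (- 1) z) + \<i> * of_real (q \<i> z) - \<i> * of_real (q (- \<i>) z)" for z
    proof -
      have "4 * (f z * cnj (g z) * of_real (exp (- \<nu> * (cmod z)\<^sup>2)))
          = of_real (exp (- \<nu> * (cmod z)\<^sup>2)) * (4 * (f z * cnj (g z)))"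
        by simp
      then show ?thesis
        unfolding polar q_def h_def by (simp add: algebra_simps)
    qed
    then have "4 * gauss_ip \<nu> f g = (LINT z|lborel. of_real (q 1 z) - of_real (q (- 1) z)
        + \<i> * of_real (q \<i> z) - \<i> * of_real (q (- \<i>) z))"
      unfolding gauss_ip_def by (simp flip: integral_mult_right_zero)
    then show ?thesis
      by (simp add: *)
  qed
  ultimately have "(\<lambda>n. 4 * (of_real (c n) * taylor_coeff f n * cnj (taylor_coeff g n))) sums (4 * gauss_ip \<nu> f g)"
    using S by simp
  then show ?thesis
    by (subst (asm) sums_mult_iff) (simp_all add: c_def)
qed

section \<open>Weighted spaces of entire functions\<close>

text \<open>
  The form \<open>ip\<close> is a parameter constrained only on \<open>H\<close>: a Bochner integral takes the
  junk value \<open>0\<close> when its integrand is not integrable, so no series formula holds globally.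
\<close>

locale weighted_entire_space =
  fixes \<sigma> :: "nat \<Rightarrow> real"
    and H :: "(complex \<Rightarrow> complex) set"
    and ip :: "(complex \<Rightarrow> complex) \<Rightarrow> (complex \<Rightarrow> complex) \<Rightarrow> complex"
  assumes weight_pos: "\<sigma> n > 0"
    and weight_summable: "x \<ge> 0 \<Longrightarrow> summable (\<lambda>n. x ^ n / \<sigma> n)"
    and mem_iff: "f \<in> H \<longleftrightarrow> f holomorphic_on UNIV \<and> summable (\<lambda>n. \<sigma> n * (cmod (taylor_coeff f n))\<^sup>2)"
    and ip_sums: "f \<in> H \<Longrightarrow> g \<in> H \<Longrightarrow>
      (\<lambda>n. of_real (\<sigma> n) * taylor_coeff f n * cnj (taylor_coeff g n)) sums ip f g"
begin

lemma mem_holomorphic: "f \<in> H \<Longrightarrow> f holomorphic_on UNIV"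
  by (simp add: mem_iff)

lemma taylor_coeff_sums_mem: "f \<in> H \<Longrightarrow> (\<lambda>n. taylor_coeff f n * z ^ n) sums f z"
  by (rule taylor_coeff_sums[OF mem_holomorphic])

lemma norm_sums:
  assumes "f \<in> H"
  shows "(\<lambda>n. \<sigma> n * (cmod (taylor_coeff f n))\<^sup>2) sums Re (ip f f)"
proof -
  have "(\<lambda>n. Re (of_real (\<sigma> n) * taylor_coeff f n * cnj (taylor_coeff f n))) sums Re (ip f f)"
    by (intro sums_Re ip_sums assms)
  moreover have "Re (of_real (\<sigma> n) * taylor_coeff f n * cnj (taylor_coeff f n))
      = \<sigma> n * (cmod (taylor_coeff f n))\<^sup>2" for n
    by (simp add: mult.assoc complex_norm_square[symmetric] del: of_real_power flip: of_real_mult)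
  ultimately show ?thesis by simp
qed

lemma norm_nonneg:
  assumes "f \<in> H"
  shows "0 \<le> Re (ip f f)"
  by (rule sums_le[OF _ sums_zero norm_sums[OF assms]]) (simp add: weight_pos less_imp_le)

text \<open>Finite sections pass to coefficientwise limits, so completeness and the bound on point
  evaluations both rest on this estimate.\<close>

lemma partial_norm_le:
  assumes "f \<in> H"
  shows "(\<Sum>n<N. \<sigma> n * (cmod (taylor_coeff f n))\<^sup>2) \<le> (ip_norm ip f)\<^sup>2"
proof -
  have "(\<Sum>n<N. \<sigma> n * (cmod (taylor_coeff f n))\<^sup>2) \<le> (\<Sum>n. \<sigma> n * (cmod (taylor_coeff f n))\<^sup>2)"
    using weight_pos sums_summable[OF norm_sums[OF assms]]
    by (intro sum_le_suminf) (auto simp: less_imp_le)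
  also have "\<dots> = (ip_norm ip f)\<^sup>2"
    using norm_sums[OF assms] norm_nonneg[OF assms] by (simp add: ip_norm_def sums_iff)
  finally show ?thesis .
qed

lemma add_closed:
  assumes "f \<in> H" "g \<in> H"
  shows "(\<lambda>z. f z + g z) \<in> H"
  unfolding mem_iff
proof
  show "(\<lambda>z. f z + g z) holomorphic_on UNIV"
    using assms by (intro holomorphic_intros mem_holomorphic)
  have "(\<lambda>n. 2 * (\<sigma> n * (cmod (taylor_coeff f n))\<^sup>2) + 2 * (\<sigma> n * (cmod (taylor_coeff g n))\<^sup>2))
      sums (2 * Re (ip f f) + 2 * Re (ip g g))"
    using assms by (intro sums_add sums_mult norm_sums)
  then have "summable (\<lambda>n. 2 * (\<sigma> n * (cmod (taylor_coeff f n))\<^sup>2) + 2 * (\<sigma> n * (cmod (taylor_coeff g n))\<^sup>2))"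
    by (rule sums_summable)
  then show "summable (\<lambda>n. \<sigma> n * (cmod (taylor_coeff (\<lambda>z. f z + g z) n))\<^sup>2)"
  proof (rule summable_comparison_test'[where N = 0])
    fix n
    let ?a = "taylor_coeff f n" and ?b = "taylor_coeff g n"
    have "(cmod (?a + ?b))\<^sup>2 \<le> (cmod ?a + cmod ?b)\<^sup>2"
      by (intro power_mono norm_triangle_ineq) auto
    also have "\<dots> \<le> 2 * (cmod ?a)\<^sup>2 + 2 * (cmod ?b)\<^sup>2"
      using sum_squares_bound[of "cmod ?a" "cmod ?b"] by (simp add: power2_sum)
    finally have "\<sigma> n * (cmod (?a + ?b))\<^sup>2 \<le> \<sigma> n * (2 * (cmod ?a)\<^sup>2 + 2 * (cmod ?b)\<^sup>2)"
      using weight_pos[of n] by (intro mult_left_mono) auto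
    then show "norm (\<sigma> n * (cmod (taylor_coeff (\<lambda>z. f z + g z) n))\<^sup>2)
        \<le> 2 * (\<sigma> n * (cmod ?a)\<^sup>2) + 2 * (\<sigma> n * (cmod ?b)\<^sup>2)"
      using assms weight_pos[of n]
      by (simp add: taylor_coeff_add mem_holomorphic abs_mult algebra_simps)
  qed
qed

lemma scale_closed:
  assumes "f \<in> H"
  shows "(\<lambda>z. c * f z) \<in> H"
  unfolding mem_iff
proof
  show "(\<lambda>z. c * f z) holomorphic_on UNIV"
    using assms by (intro holomorphic_intros mem_holomorphic)
  have "summable (\<lambda>n. (cmod c)\<^sup>2 * (\<sigma> n * (cmod (taylor_coeff f n))\<^sup>2))"
    using norm_sums[OF assms] by (intro summable_mult sums_summable)
  then show "summable (\<lambda>n. \<sigma> n * (cmod (taylor_coeff (\<lambda>z. c * f z) n))\<^sup>2)"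
    using assms by (simp add: taylor_coeff_mult_const mem_holomorphic norm_mult power_mult_distrib mult_ac)
qed

lemma diff_closed:
  assumes "f \<in> H" "g \<in> H"
  shows "(\<lambda>z. f z - g z) \<in> H"
  using add_closed[OF assms(1) scale_closed[OF assms(2), of "- 1"]] by simp

lemma taylor_coeff_diff:
  assumes "f \<in> H" "g \<in> H"
  shows "taylor_coeff (\<lambda>z. f z - g z) n = taylor_coeff f n - taylor_coeff g n"
proof -
  have "taylor_coeff (\<lambda>z. f z + - 1 * g z) n = taylor_coeff f n + - 1 * taylor_coeff g n"
    using assms scale_closed[OF assms(2), of "- 1"]
    by (simp only: taylor_coeff_add taylor_coeff_mult_const mem_holomorphic)
  then show ?thesis by simp
qed

text \<open>With s = sqrt(sigma_n), the inequality 2*x*y <= x^2 + y^2 for x = s*|a_n| and y =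
  |z|^n/s bounds |a_n * z^n| by the terms of two convergent series. Every square-summable weighted
  sequence is thus realized by an element of \<open>H\<close>.\<close>

lemma power_series_mem:
  assumes summ: "summable (\<lambda>n. \<sigma> n * (cmod (a n))\<^sup>2)"
  shows "(\<lambda>z. \<Sum>n. a n * z ^ n) \<in> H" "taylor_coeff (\<lambda>z. \<Sum>n. a n * z ^ n) = a"
proof -
  have "(\<lambda>n. a n * z ^ n) sums (\<Sum>n. a n * z ^ n)" for z
  proof -
    have "summable (\<lambda>n. \<sigma> n * (cmod (a n))\<^sup>2 + ((cmod z)\<^sup>2) ^ n / \<sigma> n)"
      by (intro summable_add summ weight_summable) simp
    then have "summable (\<lambda>n. a n * z ^ n)"
    proof (rule summable_comparison_test'[where N = 0])
      fix n
      define s where "s = sqrt (\<sigma> n)"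
      have s: "s > 0" "\<sigma> n = s\<^sup>2"
        using weight_pos[of n] by (simp_all add: s_def less_imp_le)
      have "norm (a n * z ^ n) \<le> 2 * (s * cmod (a n)) * (cmod z ^ n / s)"
        using s by (simp add: norm_mult norm_power)
      also have "\<dots> \<le> (s * cmod (a n))\<^sup>2 + (cmod z ^ n / s)\<^sup>2"
        by (rule sum_squares_bound)
      also have "\<dots> = \<sigma> n * (cmod (a n))\<^sup>2 + ((cmod z)\<^sup>2) ^ n / \<sigma> n"
        by (simp add: s(2) power_mult_distrib power_divide flip: power_mult) (simp add: mult.commute)
      finally show "norm (a n * z ^ n) \<le> \<sigma> n * (cmod (a n))\<^sup>2 + ((cmod z)\<^sup>2) ^ n / \<sigma> n" .
    qed
    then show ?thesis by (rule summable_sums)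
  qed
  note * = this
  show tc: "taylor_coeff (\<lambda>z. \<Sum>n. a n * z ^ n) = a"
    by (rule taylor_coeff_power_series[OF *])
  show "(\<lambda>z. \<Sum>n. a n * z ^ n) \<in> H"
    unfolding mem_iff tc using summ power_series_entire[OF *] by simp
qed

text \<open>The laws for \<open>ip\<close> hold term by term in its series, and sums are unique. For
  definiteness, a vanishing norm kills every Taylor coefficient, hence the function.\<close>

sublocale complex_inner_function_space H ip
proof
  show "(\<lambda>_. 0) \<in> H"
    using power_series_mem(1)[of "\<lambda>_. 0"] by simp
  show "(\<lambda>x. f x + g x) \<in> H" if "f \<in> H" "g \<in> H" for f g
    using that by (rule add_closed)
  show "(\<lambda>x. c * f x) \<in> H" if "f \<in> H" for f c
    using that by (rule scale_closed)
  show "ip (\<lambda>x. f x + g x) h = ip f h + ip g h" if "f \<in> H" "g \<in> H" "h \<in> H" for f g h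
    using ip_sums[OF add_closed[OF that(1,2)] that(3)] sums_add[OF ip_sums[OF that(1,3)] ip_sums[OF that(2,3)]] that
    by (simp add: taylor_coeff_add mem_holomorphic algebra_simps sums_iff)
  show "ip (\<lambda>x. c * f x) g = c * ip f g" if "f \<in> H" "g \<in> H" for f g c
    using ip_sums[OF scale_closed[OF that(1)] that(2), of c] sums_mult[OF ip_sums[OF that], of c] that
    by (simp add: taylor_coeff_mult_const mem_holomorphic mult_ac sums_iff)
  show "ip g f = cnj (ip f g)" if "f \<in> H" "g \<in> H" for f g
  proof -
    have "(\<lambda>n. cnj (of_real (\<sigma> n) * taylor_coeff f n * cnj (taylor_coeff g n))) sums cnj (ip f g)"
      using ip_sums[OF that] by (simp only: sums_cnj)
    with ip_sums[OF that(2,1)] show ?thesis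
      by (simp add: mult_ac sums_iff)
  qed
  show "0 \<le> Re (ip f f)" if "f \<in> H" for f
    using that by (rule norm_nonneg)
  show "f = (\<lambda>_. 0)" if "f \<in> H" "ip f f = 0" for f
  proof
    fix z
    have "taylor_coeff f n = 0" for n
    proof -
      have "(\<lambda>n. \<sigma> n * (cmod (taylor_coeff f n))\<^sup>2) sums 0"
        using norm_sums[OF that(1)] that(2) by simp
      then have "\<sigma> n * (cmod (taylor_coeff f n))\<^sup>2 = 0"
        using suminf_eq_zero_iff[of "\<lambda>n. \<sigma> n * (cmod (taylor_coeff f n))\<^sup>2"] weight_pos
        by (auto simp: sums_iff less_imp_le)
      then show ?thesis
        using weight_pos[of n] by simp
    qed
    then show "f z = 0"
      using taylor_coeff_sums_mem[OF that(1), of z] by (simp add: sums_iff)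
  qed
qed

section \<open>Completeness\<close>

text \<open>This is the argument for weighted square-summable sequences: each coefficient is Cauchy,
  the limits are the coefficients of the candidate, and bounds on finite sections survive the
  limit.\<close>

lemma complete_mem:
  fixes F :: "nat \<Rightarrow> complex \<Rightarrow> complex"
  assumes mem: "\<And>n. F n \<in> H"
    and cauchy: "\<And>e. e > 0 \<Longrightarrow> \<exists>N. \<forall>i\<ge>N. \<forall>j\<ge>N. ip_norm ip (\<lambda>z. F i z - F j z) < e"
  shows "\<exists>f\<in>H. (\<lambda>n. ip_norm ip (\<lambda>z. F n z - f z)) \<longlonglongrightarrow> 0"
proof -
  define A where "A i n = taylor_coeff (F i) n" for i n
  have partial: "(\<Sum>n<N. \<sigma> n * (cmod (A i n - A j n))\<^sup>2) \<le> (ip_norm ip (\<lambda>z. F i z - F j z))\<^sup>2" for i j N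
    using partial_norm_le[OF diff_closed[OF mem mem], of i j N] by (simp add: taylor_coeff_diff mem A_def)
  have ip_norm_nonneg: "0 \<le> ip_norm ip f" if "f \<in> H" for f
    using norm_nonneg[OF that] by (simp add: ip_norm_def)
  have "Cauchy (\<lambda>i. A i n)" for n
  proof (rule metric_CauchyI)
    fix e :: real
    assume e: "e > 0"
    \<comment> \<open>The factor sqrt(sigma_n) compensates the weight of the single coefficient n,
      leaving exactly e.\<close>
    obtain N where N: "\<And>i j. i \<ge> N \<Longrightarrow> j \<ge> N \<Longrightarrow> ip_norm ip (\<lambda>z. F i z - F j z) < sqrt (\<sigma> n) * e"
      using cauchy[of "sqrt (\<sigma> n) * e"] e weight_pos[of n] by auto
    have "dist (A i n) (A j n) < e" if "i \<ge> N" "j \<ge> N" for i j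
    proof -
      have "\<sigma> n * (cmod (A i n - A j n))\<^sup>2 \<le> (\<Sum>n<Suc n. \<sigma> n * (cmod (A i n - A j n))\<^sup>2)"
        using weight_pos by (intro member_le_sum) (auto simp: less_imp_le)
      also have "\<dots> \<le> (ip_norm ip (\<lambda>z. F i z - F j z))\<^sup>2"
        by (rule partial)
      also have "\<dots> < (sqrt (\<sigma> n) * e)\<^sup>2"
        using N[OF that] ip_norm_nonneg[OF diff_closed[OF mem mem]] by (intro power_strict_mono) auto
      also have "\<dots> = \<sigma> n * e\<^sup>2"
        using weight_pos[of n] by (simp add: power_mult_distrib)
      finally have "(cmod (A i n - A j n))\<^sup>2 < e\<^sup>2"
        using weight_pos[of n] by simp
      then show ?thesis
        using e by (simp add: dist_norm power2_less_imp_less)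
    qed
    then show "\<exists>M. \<forall>i\<ge>M. \<forall>j\<ge>M. dist (A i n) (A j n) < e" by blast
  qed
  then obtain a where a: "\<And>n. (\<lambda>i. A i n) \<longlonglongrightarrow> a n"
    unfolding Cauchy_convergent_iff convergent_def by metis
  \<comment> \<open>Fix i and let j tend to infinity in a finite section; the bound does not depend
    on the length K.\<close>
  have limit_partial: "(\<Sum>n<K. \<sigma> n * (cmod (A i n - a n))\<^sup>2) \<le> e\<^sup>2"
    if N: "\<And>i j. i \<ge> N \<Longrightarrow> j \<ge> N \<Longrightarrow> ip_norm ip (\<lambda>z. F i z - F j z) < e" and i: "i \<ge> N" for N i K e
  proof (rule LIMSEQ_le_const2)
    show "(\<lambda>j. \<Sum>n<K. \<sigma> n * (cmod (A i n - A j n))\<^sup>2) \<longlonglongrightarrow> (\<Sum>n<K. \<sigma> n * (cmod (A i n - a n))\<^sup>2)"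
      by (intro tendsto_intros a)
    have "(\<Sum>n<K. \<sigma> n * (cmod (A i n - A j n))\<^sup>2) \<le> e\<^sup>2" if "j \<ge> N" for j
    proof (rule order_trans[OF partial])
      show "(ip_norm ip (\<lambda>z. F i z - F j z))\<^sup>2 \<le> e\<^sup>2"
        using N[OF i that] ip_norm_nonneg[OF diff_closed[OF mem mem]] by (intro power_mono) auto
    qed
    then show "\<exists>M. \<forall>j\<ge>M. (\<Sum>n<K. \<sigma> n * (cmod (A i n - A j n))\<^sup>2) \<le> e\<^sup>2" by blast
  qed
  have limit_summable: "summable (\<lambda>n. \<sigma> n * (cmod (A i n - a n))\<^sup>2)"
    and limit_le: "(\<Sum>n. \<sigma> n * (cmod (A i n - a n))\<^sup>2) \<le> e\<^sup>2"
    if N: "\<And>i j. i \<ge> N \<Longrightarrow> j \<ge> N \<Longrightarrow> ip_norm ip (\<lambda>z. F i z - F j z) < e" and i: "i \<ge> N" for N i e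
  proof -
    have nonneg: "0 \<le> \<sigma> n * (cmod (A i n - a n))\<^sup>2" for n
      using weight_pos[of n] by simp
    have bd: "(\<Sum>n<K. \<sigma> n * (cmod (A i n - a n))\<^sup>2) \<le> e\<^sup>2" for K
      by (rule limit_partial[OF N i])
    show summ: "summable (\<lambda>n. \<sigma> n * (cmod (A i n - a n))\<^sup>2)"
      by (rule bounded_imp_summable[OF nonneg]) (use bd[of "Suc _"] in \<open>simp add: lessThan_Suc_atMost\<close>)
    show "(\<Sum>n. \<sigma> n * (cmod (A i n - a n))\<^sup>2) \<le> e\<^sup>2"
      by (rule suminf_le_const[OF summ bd])
  qed
  obtain N0 where N0: "\<And>i j. i \<ge> N0 \<Longrightarrow> j \<ge> N0 \<Longrightarrow> ip_norm ip (\<lambda>z. F i z - F j z) < 1"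
    using cauchy[of 1] by auto
  have "summable (\<lambda>n. \<sigma> n * (cmod (a n))\<^sup>2)"
  proof -
    \<comment> \<open>The coefficients A N0 n - a n define an element d of \<open>H\<close>;
      subtracting it from F N0 leaves an element with coefficients a, so a is square-summable
      too.\<close>
    define d where "d z = (\<Sum>n. (A N0 n - a n) * z ^ n)" for z
    have d: "d \<in> H" "taylor_coeff d = (\<lambda>n. A N0 n - a n)"
      using power_series_mem[OF limit_summable[OF N0 order_refl]] by (simp_all add: d_def[abs_def])
    have "taylor_coeff (\<lambda>z. F N0 z - d z) n = a n" for n
      by (simp add: taylor_coeff_diff mem d A_def)
    with diff_closed[OF mem[of N0] d(1)] show ?thesis
      by (simp add: mem_iff)
  qed
  then obtain f where f: "f \<in> H" and coeff_f: "\<And>n. taylor_coeff f n = a n"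
    using power_series_mem[of a] by auto
  have "(\<lambda>i. ip_norm ip (\<lambda>z. F i z - f z)) \<longlonglongrightarrow> 0"
  proof (rule LIMSEQ_I)
    fix e :: real
    assume e: "e > 0"
    \<comment> \<open>Only a weak inequality survives the limit, so e/2 is used to reach a strict
      one.\<close>
    then obtain N where N: "\<And>i j. i \<ge> N \<Longrightarrow> j \<ge> N \<Longrightarrow> ip_norm ip (\<lambda>z. F i z - F j z) < e / 2"
      using cauchy[of "e / 2"] by auto
    have "norm (ip_norm ip (\<lambda>z. F i z - f z) - 0) < e" if "i \<ge> N" for i
    proof -
      have "Re (ip (\<lambda>z. F i z - f z) (\<lambda>z. F i z - f z)) = (\<Sum>n. \<sigma> n * (cmod (A i n - a n))\<^sup>2)"
        using norm_sums[OF diff_closed[OF mem f], of i]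
        by (simp add: taylor_coeff_diff mem f coeff_f A_def sums_iff)
      also have "\<dots> \<le> (e / 2)\<^sup>2"
        by (rule limit_le[OF N that])
      finally have "ip_norm ip (\<lambda>z. F i z - f z) \<le> sqrt ((e / 2)\<^sup>2)"
        unfolding ip_norm_def by (rule real_sqrt_le_mono)
      with e ip_norm_nonneg[OF diff_closed[OF mem f], of i] show ?thesis
        by simp
    qed
    then show "\<exists>N. \<forall>i\<ge>N. norm (ip_norm ip (\<lambda>z. F i z - f z) - 0) < e" by blast
  qed
  with f show ?thesis by blast
qed

section \<open>Reproducing kernel and point evaluations\<close>

text \<open>The weighted square sum of these coefficients is the series of |w|^(2n)/sigma_n,
  convergent by \<open>weight_summable\<close>.\<close>

lemma kernel_mem:
  fixes w :: complex
  defines "K \<equiv> \<lambda>z. \<Sum>n. (z * cnj w) ^ n / of_real (\<sigma> n)"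
  shows "K \<in> H" "taylor_coeff K n = cnj w ^ n / of_real (\<sigma> n)"
proof -
  have "\<sigma> n * (cmod (cnj w ^ n / of_real (\<sigma> n)))\<^sup>2 = ((cmod w)\<^sup>2) ^ n / \<sigma> n" for n
    using weight_pos[of n]
    by (simp add: norm_divide norm_power power_divide power2_eq_square power_mult_distrib)
  then have summ: "summable (\<lambda>n. \<sigma> n * (cmod (cnj w ^ n / of_real (\<sigma> n)))\<^sup>2)"
    using weight_summable[of "(cmod w)\<^sup>2"] by simp
  have K: "K = (\<lambda>z. \<Sum>n. cnj w ^ n / of_real (\<sigma> n) * z ^ n)"
    by (simp add: K_def power_mult_distrib mult.commute)
  show "K \<in> H" "taylor_coeff K n = cnj w ^ n / of_real (\<sigma> n)"
    using power_series_mem[OF summ] by (simp_all add: K)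
qed

text \<open>In the pairing of f with the kernel at w the weights cancel, leaving the Taylor series
  of f at w.\<close>

lemma reproducing_kernel:
  "is_reproducing_kernel H ip (\<lambda>z w. \<Sum>n. (z * cnj w) ^ n / of_real (\<sigma> n))"
  unfolding is_reproducing_kernel_def
proof (intro allI conjI ballI)
  fix w f
  assume f: "f \<in> H"
  have "of_real (\<sigma> n) * taylor_coeff f n * cnj (cnj w ^ n / of_real (\<sigma> n)) = taylor_coeff f n * w ^ n" for n
    using weight_pos[of n] by simp
  then show "f w = ip f (\<lambda>z. \<Sum>n. (z * cnj w) ^ n / of_real (\<sigma> n))"
    using ip_sums[OF f kernel_mem(1)[of w]] taylor_coeff_sums_mem[OF f, of w]
    by (simp only: kernel_mem(2) sums_iff)
qed (rule kernel_mem)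

text \<open>Cauchy-Schwarz on the partial sums, each term split as (|w|^n/sqrt(sigma_n)) *
  (sqrt(sigma_n)*|a_n|). The constant is the square root of the kernel at (w, w).\<close>

lemma eval_le:
  assumes f: "f \<in> H"
  shows "cmod (f w) \<le> sqrt (\<Sum>n. ((cmod w)\<^sup>2) ^ n / \<sigma> n) * ip_norm ip f"
proof -
  let ?S = "\<Sum>n. ((cmod w)\<^sup>2) ^ n / \<sigma> n"
  have "(cmod (f w))\<^sup>2 \<le> ?S * (ip_norm ip f)\<^sup>2"
  proof (rule LIMSEQ_le_const2)
    show "(\<lambda>N. (cmod (\<Sum>n<N. taylor_coeff f n * w ^ n))\<^sup>2) \<longlonglongrightarrow> (cmod (f w))\<^sup>2"
      using taylor_coeff_sums_mem[OF f, of w] by (intro tendsto_intros) (simp add: sums_def)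
    have "(cmod (\<Sum>n<N. taylor_coeff f n * w ^ n))\<^sup>2 \<le> ?S * (ip_norm ip f)\<^sup>2" for N
    proof -
      have "cmod (\<Sum>n<N. taylor_coeff f n * w ^ n)
          \<le> (\<Sum>n<N. (cmod w ^ n / sqrt (\<sigma> n)) * (sqrt (\<sigma> n) * cmod (taylor_coeff f n)))"
        using weight_pos by (intro order_trans[OF norm_sum] sum_mono)
          (auto simp: norm_mult norm_power less_imp_neq[THEN not_sym])
      then have "(cmod (\<Sum>n<N. taylor_coeff f n * w ^ n))\<^sup>2
          \<le> (\<Sum>n<N. (cmod w ^ n / sqrt (\<sigma> n)) * (sqrt (\<sigma> n) * cmod (taylor_coeff f n)))\<^sup>2"
        by (intro power_mono) auto
      also have "\<dots> \<le> (\<Sum>n<N. (cmod w ^ n / sqrt (\<sigma> n))\<^sup>2) * (\<Sum>n<N. (sqrt (\<sigma> n) * cmod (taylor_coeff f n))\<^sup>2)"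
        by (rule Cauchy_Schwarz_ineq_sum)
      also have "\<dots> = (\<Sum>n<N. ((cmod w)\<^sup>2) ^ n / \<sigma> n) * (\<Sum>n<N. \<sigma> n * (cmod (taylor_coeff f n))\<^sup>2)"
        using weight_pos
        by (simp add: power_divide power_mult_distrib less_imp_le power_mult[symmetric] mult.commute[of _ 2])
      also have "\<dots> \<le> ?S * (ip_norm ip f)\<^sup>2"
        using weight_pos
        by (intro mult_mono partial_norm_le f sum_le_suminf weight_summable)
          (auto intro!: sum_nonneg suminf_nonneg weight_summable simp: less_imp_le)
      finally show ?thesis .
    qed
    then show "\<exists>N. \<forall>n\<ge>N. (cmod (\<Sum>n<n. taylor_coeff f n * w ^ n))\<^sup>2 \<le> ?S * (ip_norm ip f)\<^sup>2" by blast
  qed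
  then have "cmod (f w) \<le> sqrt (?S * (ip_norm ip f)\<^sup>2)"
    by (rule real_le_rsqrt)
  then show ?thesis
    using norm_nonneg[OF f] by (simp add: real_sqrt_mult ip_norm_def)
qed

sublocale reproducing_kernel_hilbert_space H ip
proof
  show "\<exists>C. \<forall>f\<in>H. cmod (f w) \<le> C * ip_norm ip f" for w
    using eval_le by blast
qed (rule complete_mem)

end

section \<open>The generalized Bargmann space\<close>

text \<open>The squared norm of z^n. For n >= m it is the Gaussian norm of the m-th derivative
  n!/(n-m)! * z^(n-m), that is (n!/(n-m)!)^2 * pi * (n-m)!/nu^(n-m+1).\<close>

definition bargmann_weight :: "real \<Rightarrow> nat \<Rightarrow> nat \<Rightarrow> real" where
  "bargmann_weight \<nu> m n =
     (if n < m then pi * fact n / \<nu> ^ (n + 1)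
      else pi * (fact n)\<^sup>2 / (\<nu> ^ (n - m + 1) * fact (n - m)))"

lemma bargmann_weight_pos: "\<nu> > 0 \<Longrightarrow> bargmann_weight \<nu> m n > 0"
  by (simp add: bargmann_weight_def)

text \<open>Since k!/((k+m)!)^2 <= 1/k!, the tail from m on is dominated by a multiple of the
  exponential series at nu*x.\<close>

lemma bargmann_weight_summable:
  assumes "\<nu> > 0" "x \<ge> 0"
  shows "summable (\<lambda>n. x ^ n / bargmann_weight \<nu> m n)"
proof -
  have "summable (\<lambda>k. x ^ (k + m) / bargmann_weight \<nu> m (k + m))"
  proof (rule summable_comparison_test'[where N = 0])
    show "summable (\<lambda>k. x ^ m * \<nu> / pi * ((\<nu> * x) ^ k /\<^sub>R fact k))"
      by (intro summable_mult summable_exp_generic)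
    fix k
    have "(fact k :: real) * fact k \<le> fact (k + m) * fact (k + m)"
      by (intro mult_mono fact_mono) auto
    then have "(fact k :: real) / (fact (k + m))\<^sup>2 \<le> 1 / fact k"
      by (simp add: field_simps power2_eq_square)
    then have "x ^ m * \<nu> / pi * (\<nu> * x) ^ k * (fact k / (fact (k + m))\<^sup>2)
        \<le> x ^ m * \<nu> / pi * (\<nu> * x) ^ k * (1 / fact k)"
      using assms by (intro mult_left_mono) auto
    then show "norm (x ^ (k + m) / bargmann_weight \<nu> m (k + m)) \<le> x ^ m * \<nu> / pi * ((\<nu> * x) ^ k /\<^sub>R fact k)"
      using assms by (simp add: bargmann_weight_def power_add power_mult_distrib divide_inverse mult_ac)
  qed
  then show ?thesis by (subst (asm) summable_iff_shift)
qed

section \<open>Norm and form of the Bargmann space in Taylor coefficients\<close>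

text \<open>Padding the polynomial with zeros to a full power series makes
  \<open>taylor_coeff_power_series\<close> applicable to it.\<close>

lemma low_part_sums: "(\<lambda>n. (if n < m then taylor_coeff f n else 0) * z ^ n) sums low_part m f z"
  using sums_finite[of "{..<m}" "\<lambda>n. (if n < m then taylor_coeff f n else 0) * z ^ n"]
  by (simp add: low_part_def)

lemma low_part_entire: "low_part m f holomorphic_on UNIV"
  by (rule power_series_entire[OF low_part_sums])

lemma taylor_coeff_low_part: "taylor_coeff (low_part m f) n = (if n < m then taylor_coeff f n else 0)"
  by (simp add: taylor_coeff_power_series[OF low_part_sums])

lemma high_part_sums:
  assumes "f holomorphic_on UNIV"
  shows "(\<lambda>n. (if n < m then 0 else taylor_coeff f n) * z ^ n) sums high_part m f z"
proof -
  have "(\<lambda>k. taylor_coeff f (k + m) * z ^ (k + m)) sums (f z - (\<Sum>n<m. taylor_coeff f n * z ^ n))"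
    using taylor_coeff_sums[OF assms] by (rule sums_split_initial_segment)
  then have "(\<lambda>k. (if k + m < m then 0 else taylor_coeff f (k + m)) * z ^ (k + m)) sums high_part m f z"
    by (simp add: high_part_def add.commute sums_iff)
  then show ?thesis by (subst (asm) sums_iff_shift) simp
qed

lemma high_part_entire: "f holomorphic_on UNIV \<Longrightarrow> high_part m f holomorphic_on UNIV"
  by (rule power_series_entire[OF high_part_sums])

lemma high_part_deriv_entire:
  "f holomorphic_on UNIV \<Longrightarrow> (deriv ^^ m) (high_part m f) holomorphic_on UNIV"
  by (intro holomorphic_higher_deriv high_part_entire) auto

lemma taylor_coeff_high_part_deriv:
  assumes "f holomorphic_on UNIV"
  shows "taylor_coeff ((deriv ^^ m) (high_part m f)) k = fact (m + k) / fact k * taylor_coeff f (m + k)"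
  by (simp add: taylor_coeff_deriv_funpow taylor_coeff_power_series[OF high_part_sums[OF assms]])

lemma gauss_normsq_low_part:
  assumes "\<nu> > 0"
  shows "gauss_normsq \<nu> (low_part m f) = (\<Sum>n<m. ennreal (bargmann_weight \<nu> m n * (cmod (taylor_coeff f n))\<^sup>2))"
proof -
  have "gauss_normsq \<nu> (low_part m f)
      = (\<Sum>n. ennreal (pi * fact n / \<nu> ^ (n + 1) * (cmod (if n < m then taylor_coeff f n else 0))\<^sup>2))"
    using gauss_normsq_power_series[OF low_part_sums assms] .
  also have "\<dots> = (\<Sum>n<m. ennreal (bargmann_weight \<nu> m n * (cmod (taylor_coeff f n))\<^sup>2))"
    by (subst suminf_finite[of "{..<m}"]) (auto simp: bargmann_weight_def)
  finally show ?thesis .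
qed

lemma gauss_normsq_high_part:
  assumes "f holomorphic_on UNIV" "\<nu> > 0"
  shows "gauss_normsq \<nu> ((deriv ^^ m) (high_part m f))
    = (\<Sum>k. ennreal (bargmann_weight \<nu> m (m + k) * (cmod (taylor_coeff f (m + k)))\<^sup>2))"
proof -
  have "pi * fact k / \<nu> ^ (k + 1) * (cmod (taylor_coeff ((deriv ^^ m) (high_part m f)) k))\<^sup>2
      = bargmann_weight \<nu> m (m + k) * (cmod (taylor_coeff f (m + k)))\<^sup>2" for k
    using assms by (simp add: taylor_coeff_high_part_deriv bargmann_weight_def norm_mult norm_divide
        power_mult_distrib power_divide) (simp add: power2_eq_square)
  then show ?thesis
    using gauss_normsq_power_series[OF taylor_coeff_sums[OF high_part_deriv_entire[OF assms(1)]] assms(2), of m]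
    by simp
qed

lemma coeff_normsq_eq:
  assumes "\<nu> > 0"
  shows "coeff_normsq \<nu> m a = (\<Sum>n<m. ennreal (bargmann_weight \<nu> m n * (cmod (a n))\<^sup>2))
    + (\<Sum>k. ennreal (bargmann_weight \<nu> m (m + k) * (cmod (a (m + k)))\<^sup>2))"
proof -
  have "(\<Sum>n<m. ennreal pi * ennreal (fact n / \<nu> ^ (n + 1) * (cmod (a n))\<^sup>2))
      = (\<Sum>n<m. ennreal (bargmann_weight \<nu> m n * (cmod (a n))\<^sup>2))"
    by (intro sum.cong refl) (simp add: bargmann_weight_def mult.assoc flip: ennreal_mult')
  moreover have "ennreal pi * ennreal ((fact (m + k))\<^sup>2 / (\<nu> ^ (k + 1) * fact k) * (cmod (a (m + k)))\<^sup>2)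
      = ennreal (bargmann_weight \<nu> m (m + k) * (cmod (a (m + k)))\<^sup>2)" for k
    by (simp add: bargmann_weight_def mult.assoc flip: ennreal_mult')
  ultimately show ?thesis
    by (simp add: coeff_normsq_def distrib_left sum_distrib_left del: ennreal_suminf_cmult flip: ennreal_suminf_cmult)
qed

lemma coeff_normsq_finite_iff:
  assumes "\<nu> > 0"
  shows "coeff_normsq \<nu> m a < \<infinity> \<longleftrightarrow> summable (\<lambda>n. bargmann_weight \<nu> m n * (cmod (a n))\<^sup>2)"
proof -
  have nonneg: "0 \<le> bargmann_weight \<nu> m n * (cmod (a n))\<^sup>2" for n
    using bargmann_weight_pos[OF assms, of m n] by simp
  \<comment> \<open>The terms below m form a finite sum of finite values, so the tail alone decides
    finiteness.\<close>
  have "coeff_normsq \<nu> m a < \<infinity>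
      \<longleftrightarrow> (\<Sum>k. ennreal (bargmann_weight \<nu> m (m + k) * (cmod (a (m + k)))\<^sup>2)) \<noteq> top"
    by (simp add: coeff_normsq_eq[OF assms] less_top)
  also have "\<dots> \<longleftrightarrow> summable (\<lambda>k. bargmann_weight \<nu> m (m + k) * (cmod (a (m + k)))\<^sup>2)"
    using nonneg by (auto intro!: summable_suminf_not_top simp: suminf_ennreal2)
  also have "\<dots> \<longleftrightarrow> summable (\<lambda>n. bargmann_weight \<nu> m n * (cmod (a n))\<^sup>2)"
    using summable_iff_shift[of "\<lambda>n. bargmann_weight \<nu> m n * (cmod (a n))\<^sup>2" m] by (simp add: add.commute)
  finally show ?thesis .
qed

lemma bargmann_normsq_eq:
  assumes "f holomorphic_on UNIV" "\<nu> > 0"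
  shows "bargmann_normsq \<nu> m f = coeff_normsq \<nu> m (taylor_coeff f)"
  using assms by (simp add: bargmann_normsq_def gauss_normsq_low_part gauss_normsq_high_part coeff_normsq_eq)

text \<open>A finite Bargmann norm makes both Gaussian norms finite, so \<open>gauss_ip_sums\<close>
  applies to each half. The low half gives the first m terms, the derivative half the tail shifted
  by m.\<close>

lemma bargmann_ip_sums:
  assumes "\<nu> > 0" and f: "f \<in> bargmann_space \<nu> m" and g: "g \<in> bargmann_space \<nu> m"
  shows "(\<lambda>n. of_real (bargmann_weight \<nu> m n) * taylor_coeff f n * cnj (taylor_coeff g n))
    sums bargmann_ip \<nu> m f g"
proof -
  let ?t = "\<lambda>n. of_real (bargmann_weight \<nu> m n) * taylor_coeff f n * cnj (taylor_coeff g n)"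
  have hol: "f holomorphic_on UNIV" "g holomorphic_on UNIV"
    and fin: "bargmann_normsq \<nu> m f < \<infinity>" "bargmann_normsq \<nu> m g < \<infinity>"
    using f g by (auto simp: bargmann_space_def)
  have fin': "gauss_normsq \<nu> (low_part m f) < \<infinity>" "gauss_normsq \<nu> (low_part m g) < \<infinity>"
    "gauss_normsq \<nu> ((deriv ^^ m) (high_part m f)) < \<infinity>" "gauss_normsq \<nu> ((deriv ^^ m) (high_part m g)) < \<infinity>"
    using fin by (auto simp: bargmann_normsq_def)
  have "(\<lambda>n. of_real (pi * fact n / \<nu> ^ (n + 1)) * taylor_coeff (low_part m f) n * cnj (taylor_coeff (low_part m g) n))
      sums gauss_ip \<nu> (low_part m f) (low_part m g)"
    by (rule gauss_ip_sums[OF low_part_entire low_part_entire assms(1) fin'(1,2)])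
  moreover have "(\<lambda>n. of_real (pi * fact n / \<nu> ^ (n + 1)) * taylor_coeff (low_part m f) n * cnj (taylor_coeff (low_part m g) n))
      sums (\<Sum>n<m. of_real (pi * fact n / \<nu> ^ (n + 1)) * taylor_coeff (low_part m f) n * cnj (taylor_coeff (low_part m g) n))"
    by (rule sums_finite) (auto simp: taylor_coeff_low_part)
  ultimately have low: "gauss_ip \<nu> (low_part m f) (low_part m g) = (\<Sum>n<m. ?t n)"
    by (auto simp: taylor_coeff_low_part bargmann_weight_def dest: sums_unique2)
  have "(\<lambda>k. of_real (pi * fact k / \<nu> ^ (k + 1)) * taylor_coeff ((deriv ^^ m) (high_part m f)) k
        * cnj (taylor_coeff ((deriv ^^ m) (high_part m g)) k))
      sums gauss_ip \<nu> ((deriv ^^ m) (high_part m f)) ((deriv ^^ m) (high_part m g))"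
    by (rule gauss_ip_sums[OF high_part_deriv_entire high_part_deriv_entire assms(1) fin'(3,4)]) (rule hol)+
  moreover have "of_real (pi * fact k / \<nu> ^ (k + 1)) * taylor_coeff ((deriv ^^ m) (high_part m f)) k
        * cnj (taylor_coeff ((deriv ^^ m) (high_part m g)) k) = ?t (k + m)" for k
    using hol by (simp add: taylor_coeff_high_part_deriv bargmann_weight_def add.commute power2_eq_square)
  ultimately have "(\<lambda>k. ?t (k + m)) sums gauss_ip \<nu> ((deriv ^^ m) (high_part m f)) ((deriv ^^ m) (high_part m g))"
    by simp
  then show ?thesis
    by (subst (asm) sums_iff_shift) (simp add: bargmann_ip_def low add.commute)
qed

lemma bargmann_weighted_entire_space:
  assumes "\<nu> > 0"
  shows "weighted_entire_space (bargmann_weight \<nu> m) (bargmann_space \<nu> m) (bargmann_ip \<nu> m)"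
proof
  show "f \<in> bargmann_space \<nu> m \<longleftrightarrow>
      f holomorphic_on UNIV \<and> summable (\<lambda>n. bargmann_weight \<nu> m n * (cmod (taylor_coeff f n))\<^sup>2)" for f
    using assms by (auto simp: bargmann_space_def bargmann_normsq_eq coeff_normsq_finite_iff[symmetric])
qed (use assms in \<open>auto intro: bargmann_weight_pos bargmann_weight_summable bargmann_ip_sums\<close>)

section \<open>Closed form of the kernel\<close>

text \<open>Split the series at m. In the tail, (1)_k = k! and (m+1)_k = (m+k)!/m! turn the
  reciprocal weights into the coefficients of the hypergeometric series.\<close>

lemma bargmann_kernel_eq:
  assumes "\<nu> > 0"
  shows "bargmann_kernel \<nu> m z w = (\<Sum>n. (z * cnj w) ^ n / of_real (bargmann_weight \<nu> m n))"
proof -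
  let ?x = "z * cnj w" and ?t = "\<lambda>n. (z * cnj w) ^ n / of_real (bargmann_weight \<nu> m n)"
  have "summable ?t"
  proof (rule summable_norm_cancel)
    have "norm (?t n) = cmod ?x ^ n / bargmann_weight \<nu> m n" for n
      using bargmann_weight_pos[OF assms, of m n] by (simp add: norm_divide norm_power)
    then show "summable (\<lambda>n. norm (?t n))"
      using bargmann_weight_summable[OF assms, of "cmod ?x" m] by simp
  qed
  then have split: "suminf ?t = (\<Sum>k. ?t (k + m)) + (\<Sum>n<m. ?t n)" and summ: "summable (\<lambda>k. ?t (k + m))"
    by (rule suminf_split_initial_segment, subst summable_iff_shift)
  have low: "?t n = of_real (\<nu> / pi) * ((of_real \<nu> * z * cnj w) ^ n / fact n)" if "n < m" for n
    using that assms by (simp add: bargmann_weight_def field_simps power_mult_distrib)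
  have poch: "pochhammer (of_nat (m + 1)) k * fact m = (fact (k + m) :: complex)" for k
    using pochhammer_product'[of "1 :: complex" m k]
    by (simp add: pochhammer_fact[symmetric] add.commute mult.commute)
  define h where "h k = (pochhammer 1 k * pochhammer 1 k) / (pochhammer (of_nat (m + 1)) k * pochhammer (of_nat (m + 1)) k)
    * ((of_real \<nu> * z * cnj w) ^ k / fact k)" for k
  have high: "?t (k + m) = of_real (\<nu> / pi) * (?x ^ m / (fact m)\<^sup>2) * h k" for k
  proof -
    have p: "pochhammer (of_nat (m + 1)) k = (fact (k + m) / fact m :: complex)"
      by (simp add: poch[symmetric])
    show ?thesis
      unfolding h_def p
      using assms by (simp add: bargmann_weight_def pochhammer_fact[symmetric] field_simps power_add power_mult_distrib power2_eq_square)
  qed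
  have "(\<Sum>k. ?t (k + m)) = of_real (\<nu> / pi) * (?x ^ m / (fact m)\<^sup>2) * (\<Sum>k. h k)"
  \<comment> \<open>If the prefactor vanishes, both sides are 0 and the tail says nothing about h.
    Otherwise summability of h follows from that of the tail by cancelling a nonzero
    constant.\<close>
  proof (cases "?x ^ m = 0")
    case True
    show ?thesis unfolding high True by simp
  next
    case False
    then have "summable h"
      using summ assms by (simp only: high) (subst (asm) summable_cmult_iff, auto)
    then show ?thesis
      unfolding high by (rule suminf_mult)
  qed
  moreover have "(\<Sum>k. h k) = hypergeom_2F2 1 1 (of_nat (m + 1)) (of_nat (m + 1)) (of_real \<nu> * z * cnj w)"
    by (simp add: hypergeom_2F2_def h_def)
  moreover have "Gamma (of_nat (m + 1)) = (fact m :: complex)"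
    using Gamma_fact[of m] by (simp add: add.commute)
  moreover have "(\<Sum>n<m. ?t n) = of_real (\<nu> / pi) * (\<Sum>n<m. (of_real \<nu> * z * cnj w) ^ n / fact n)"
    unfolding sum_distrib_left by (intro sum.cong refl low) simp
  ultimately show ?thesis
    unfolding bargmann_kernel_def split by (simp only: algebra_simps)
qed

theorem theorem1p3:
  fixes \<nu> :: real and m :: nat
  assumes "\<nu> > 0"
  shows "reproducing_kernel_hilbert_space (bargmann_space \<nu> m) (bargmann_ip \<nu> m) \<and>
    is_reproducing_kernel (bargmann_space \<nu> m) (bargmann_ip \<nu> m) (bargmann_kernel \<nu> m) \<and>
    (\<forall>(f :: complex \<Rightarrow> complex) (a :: nat \<Rightarrow> complex). (\<forall>z. (\<lambda>n. a n * z ^ n) sums f z) \<longrightarrow>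
       bargmann_normsq \<nu> m f = coeff_normsq \<nu> m a \<and>
       (f \<in> bargmann_space \<nu> m \<longleftrightarrow> coeff_normsq \<nu> m a < \<infinity>))"
proof (intro conjI allI impI)
  interpret weighted_entire_space "bargmann_weight \<nu> m" "bargmann_space \<nu> m" "bargmann_ip \<nu> m"
    by (rule bargmann_weighted_entire_space[OF assms])
  show "reproducing_kernel_hilbert_space (bargmann_space \<nu> m) (bargmann_ip \<nu> m)"
    by unfold_locales
  have "bargmann_kernel \<nu> m = (\<lambda>z w. \<Sum>n. (z * cnj w) ^ n / of_real (bargmann_weight \<nu> m n))"
    by (intro ext bargmann_kernel_eq assms)
  then show "is_reproducing_kernel (bargmann_space \<nu> m) (bargmann_ip \<nu> m) (bargmann_kernel \<nu> m)"
    using reproducing_kernel by simp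
  fix f :: "complex \<Rightarrow> complex" and a :: "nat \<Rightarrow> complex"
  assume "\<forall>z. (\<lambda>n. a n * z ^ n) sums f z"
  then have *: "(\<lambda>n. a n * z ^ n) sums f z" for z by blast
  note hol = power_series_entire[OF *]
  show eq: "bargmann_normsq \<nu> m f = coeff_normsq \<nu> m a"
    using bargmann_normsq_eq[OF hol assms] by (simp add: taylor_coeff_power_series[OF *])
  show "f \<in> bargmann_space \<nu> m \<longleftrightarrow> coeff_normsq \<nu> m a < \<infinity>"
    by (simp add: bargmann_space_def hol eq)
qed

end
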